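(* Let $\boldsymbol{M}$ be the Polish space of all infinite minimal subshifts with some finite alphabet $\mathsf{A}\subseteq\mathbb{Z}$. The set of all Toeplitz subshifts $(X,S)$ such that $(X,S)$ is not conjugate to its inverse $(X,S^{-1})$ is generic in $\boldsymbol{M}$.
   Context: For a finite alphabet $\mathsf{A}$, $S$ is the shift on $\mathsf{A}^{\mathbb{Z}}$, $S(x)(i)=x(i+1)$. A subshift is a closed set $X\subseteq\mathsf{A}^{\mathbb{Z}}$ with $S(X)=X$; it is minimal if every $S$-orbit is dense. Systems $(X,T)$, $(Y,T')$ are conjugate if there is a homeomorphism $\varphi\colon X\to Y$ with $\varphi\circ T=T'\circ\varphi$. A sequence $x\in\mathsf{A}^{\mathbb{Z}}$ is a Toeplitz sequence if for every $i\in\mathbb{Z}$ there is $p\geq1$ with $x(i)=x(i+kp)$ for all $k\in\mathbb{Z}$. A Toeplitz subshift is the closure in $\mathsf{A}^{\mathbb{Z}}$ of the $S$-orbit of a Toeplitz sequence (it is always minimal). Let $\boldsymbol{S}$ be the space of all subshifts with some finite alphabet $\mathsf{A}\subseteq\mathbb{Z}$, with metric $d(X,Y)=2^{-\inf\{n\,:\,L_n(X)\neq L_n(Y)\}}$, where $L_n(X)$ is the set of words of length $n$ occurring in elements of $X$. It is Polish, and $\boldsymbol{M}\subseteq\boldsymbol{S}$, the set of infinite minimal subshifts with the subspace topology, is a $G_\delta$ subset, hence Polish. A subset of a Polish space is generic if it contains a dense $G_\delta$ subset. *)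

theory Defs
  imports "HOL-Analysis.Analysis"
begin

text \<open>
  Two-sided sequences over finite alphabets \<open>A \<subseteq> \<int>\<close> are functions \<^typ>\<open>int \<Rightarrow> int\<close>. The topology of
  type \<^typ>\<open>int\<close> is discrete and the topology of a function type is the product topology, so the
  topology that \<open>full_shift A\<close> inherits from \<^typ>\<open>int \<Rightarrow> int\<close> is the product of discrete topologies.
\<close>

definition shift :: "(int \<Rightarrow> 'a) \<Rightarrow> int \<Rightarrow> 'a" where
  "shift x = (\<lambda>i. x (i + 1))"

lemma bij_shift: "bij shift"
  by (rule o_bij[where g = "\<lambda>x i. x (i - 1)"]) (auto simp: shift_def fun_eq_iff)

lemma inv_shift: "inv shift = (\<lambda>x i. x (i - 1))"
  by (rule inv_unique_comp) (auto simp: shift_def fun_eq_iff)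

definition full_shift :: "int set \<Rightarrow> (int \<Rightarrow> int) set" where
  "full_shift A = {x. \<forall>i. x i \<in> A}"

text \<open>\<open>\<lambda>i. x (i + k)\<close> is the image of \<open>x\<close> under the \<open>k\<close>-th power of the shift, for \<open>k\<close> of either sign.\<close>

definition shift_orbit :: "(int \<Rightarrow> 'a) \<Rightarrow> (int \<Rightarrow> 'a) set" where
  "shift_orbit x = {y. \<exists>k::int. y = (\<lambda>i. x (i + k))}"

lemma shift_orbit_altdef:
  "shift_orbit x = range (\<lambda>n. (shift ^^ n) x) \<union> range (\<lambda>n. (inv shift ^^ n) x)"
proof -
  have pos: "(shift ^^ n) x = (\<lambda>i. x (i + int n))" for n
    by (induction n) (auto simp: shift_def fun_eq_iff algebra_simps)
  have neg: "(inv shift ^^ n) x = (\<lambda>i. x (i + (- int n)))" for n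
    by (induction n) (auto simp: inv_shift fun_eq_iff algebra_simps)
  show ?thesis
  proof (intro equalityI subsetI)
    fix y assume "y \<in> shift_orbit x"
    then obtain k where k: "y = (\<lambda>i. x (i + k))" by (auto simp: shift_orbit_def)
    show "y \<in> range (\<lambda>n. (shift ^^ n) x) \<union> range (\<lambda>n. (inv shift ^^ n) x)"
    proof (cases k rule: int_cases2)
      case (nonneg n) then show ?thesis using k pos[of n] by (metis UnI1 rangeI)
    next
      case (nonpos n) then show ?thesis using k neg[of n] by (metis UnI2 rangeI)
    qed
  next
    fix y assume "y \<in> range (\<lambda>n. (shift ^^ n) x) \<union> range (\<lambda>n. (inv shift ^^ n) x)"
    then show "y \<in> shift_orbit x" unfolding shift_orbit_def pos neg by (elim UnE rangeE) blast+
  qed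
qed

definition subshift :: "(int \<Rightarrow> int) set \<Rightarrow> bool" where
  "subshift X \<longleftrightarrow>
     (\<exists>A. finite A \<and> closedin (top_of_set (full_shift A)) X \<and> shift ` X = X)"

definition minimal_subshift :: "(int \<Rightarrow> int) set \<Rightarrow> bool" where
  "minimal_subshift X \<longleftrightarrow>
     subshift X \<and> (\<forall>x\<in>X. top_of_set X closure_of shift_orbit x = X)"

definition toeplitz_sequence :: "(int \<Rightarrow> 'a) \<Rightarrow> bool" where
  "toeplitz_sequence x \<longleftrightarrow> (\<forall>i. \<exists>p\<ge>1. \<forall>k. x i = x (i + k * p))"

definition toeplitz_subshift :: "(int \<Rightarrow> int) set \<Rightarrow> bool" where
  "toeplitz_subshift X \<longleftrightarrow>
     (\<exists>A x. finite A \<and> x \<in> full_shift A \<and> toeplitz_sequence x \<and>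
            X = top_of_set (full_shift A) closure_of shift_orbit x)"

definition conjugate_systems ::
  "'a::topological_space set \<Rightarrow> ('a \<Rightarrow> 'a) \<Rightarrow> 'b::topological_space set \<Rightarrow> ('b \<Rightarrow> 'b) \<Rightarrow> bool" where
  "conjugate_systems X T Y T' \<longleftrightarrow>
     (\<exists>\<phi> \<psi>. homeomorphism X Y \<phi> \<psi> \<and> (\<forall>x\<in>X. \<phi> (T x) = T' (\<phi> x)))"

definition words :: "nat \<Rightarrow> (int \<Rightarrow> 'a) set \<Rightarrow> 'a list set" where
  "words n X = {map (\<lambda>j. x (i + int j)) [0..<n] | x i. x \<in> X}"

text \<open>The infimum of the empty set is \<open>\<infinity>\<close>, whence the distance \<open>0\<close> in the first case.\<close>

definition subshift_dist :: "(int \<Rightarrow> 'a) set \<Rightarrow> (int \<Rightarrow> 'a) set \<Rightarrow> real" where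
  "subshift_dist X Y =
     (if \<forall>n. words n X = words n Y then 0
      else 1 / 2 ^ Inf {n. words n X \<noteq> words n Y})"

definition subshifts :: "(int \<Rightarrow> int) set set" where
  "subshifts = {X. subshift X}"

definition infinite_minimal_subshifts :: "(int \<Rightarrow> int) set set" where
  "infinite_minimal_subshifts = {X. minimal_subshift X \<and> infinite X}"

definition subshift_topology :: "(int \<Rightarrow> int) set topology" where
  "subshift_topology = Metric_space.mtopology subshifts subshift_dist"

definition minimal_subshift_topology :: "(int \<Rightarrow> int) set topology" where
  "minimal_subshift_topology = subtopology subshift_topology infinite_minimal_subshifts"

definition generic_in :: "'a topology \<Rightarrow> 'a set \<Rightarrow> bool" where
  "generic_in T A \<longleftrightarrow>
     A \<subseteq> topspace T \<and> (\<exists>G\<subseteq>A. gdelta_in T G \<and> T closure_of G = topspace T)"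


text \<open>The constant \<^const>\<open>Metric_space.mtopology\<close> is meaningful only for a metric; hence the
  following verification.\<close>

lemma closed_full_shift: "closed (full_shift A)"
proof -
  have "full_shift A = (\<Inter>i. (\<lambda>x. x i) -` A)" by (auto simp: full_shift_def)
  moreover have "closed ((\<lambda>x::int \<Rightarrow> int. x i) -` A)" for i
    by (rule closed_vimage)
      (auto simp: closed_def open_discrete intro: continuous_on_product_then_coordinatewise[OF continuous_on_id])
  ultimately show ?thesis by auto
qed

lemma subshift_closed: "subshift X \<Longrightarrow> closed X"
  unfolding subshift_def using closed_full_shift closedin_closed_trans by blast

lemma subshift_translate:
  assumes "subshift X" "x \<in> X"
  shows "(\<lambda>i. x (i + k)) \<in> X"
proof -
  have im: "shift ` X = X" using assms(1) by (auto simp: subshift_def)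
  have a: "shift y \<in> X" if "y \<in> X" for y using imageI[OF that, of shift] by (simp only: im)
  have b: "inv shift y \<in> X" if "y \<in> X" for y
  proof -
    have "y \<in> shift ` X" using that by (simp only: im)
    then obtain z where "y = shift z" "z \<in> X" by (rule imageE)
    then show ?thesis by (simp add: inv_shift shift_def)
  qed
  have "(shift ^^ n) x \<in> X" for n by (induction n) (auto simp: a assms(2))
  moreover have "(inv shift ^^ n) x \<in> X" for n by (induction n) (auto simp: b assms(2))
  ultimately have "shift_orbit x \<subseteq> X" by (auto simp: shift_orbit_altdef)
  then show ?thesis by (auto simp: shift_orbit_def)
qed

lemma words_eq_imp_subset:
  assumes X: "subshift X" and Y: "subshift Y" and eq: "\<And>n. words n X = words n Y"
  shows "X \<subseteq> Y"
proof
  fix x assume x: "x \<in> X"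
  have "\<exists>y\<in>Y. \<forall>i. \<bar>i\<bar> \<le> int n \<longrightarrow> y i = x i" for n
  proof -
    let ?m = "2 * n + 1"
    have "map (\<lambda>j. x (- int n + int j)) [0..<?m] \<in> words ?m Y"
      unfolding eq[symmetric] using x unfolding words_def by blast
    then obtain y l where y: "y \<in> Y" and
      w: "map (\<lambda>j. x (- int n + int j)) [0..<?m] = map (\<lambda>j. y (l + int j)) [0..<?m]"
      unfolding words_def by blast
    have ag: "x (- int n + int j) = y (l + int j)" if "j < ?m" for j
    proof -
      have "map (\<lambda>j. x (- int n + int j)) [0..<?m] ! j = map (\<lambda>j. y (l + int j)) [0..<?m] ! j"
        by (simp only: w)
      then show ?thesis using that by (simp del: upt_Suc)
    qed
    let ?z = "\<lambda>i. y (i + (l + int n))"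
    have "?z i = x i" if i: "\<bar>i\<bar> \<le> int n" for i
    proof -
      have m: "nat (i + int n) < ?m" and c: "int (nat (i + int n)) = i + int n" using i by auto
      show ?thesis using ag[OF m] unfolding c by (simp add: algebra_simps)
    qed
    then show ?thesis by (intro bexI[of _ ?z] allI impI subshift_translate[OF Y y])
  qed
  then obtain z where z: "\<And>n. z n \<in> Y" "\<And>n i. \<bar>i\<bar> \<le> int n \<Longrightarrow> z n i = x i" by metis
  have "(\<lambda>n. z n i) \<longlonglongrightarrow> x i" for i
    by (rule tendsto_eventually)
      (auto simp: eventually_sequentially intro!: exI[of _ "nat \<bar>i\<bar>"] z(2))
  then have "limitin (product_topology (\<lambda>_. euclidean) UNIV) z x sequentially"
    by (simp add: limitin_componentwise)
  then have "z \<longlonglongrightarrow> x" by (simp add: euclidean_product_topology)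
  then show "x \<in> Y"
    using closed_sequentially[OF subshift_closed[OF Y]] z(1) by blast
qed

lemma Metric_space_subshifts: "Metric_space subshifts subshift_dist"
proof
  fix X Y :: "(int \<Rightarrow> int) set"
  show "0 \<le> subshift_dist X Y" by (simp add: subshift_dist_def)
  have "words n X = words n Y \<longleftrightarrow> words n Y = words n X" for n by blast
  then show "subshift_dist X Y = subshift_dist Y X" by (simp only: subshift_dist_def)
next
  fix X Y :: "(int \<Rightarrow> int) set"
  assume "X \<in> subshifts" "Y \<in> subshifts"
  then show "subshift_dist X Y = 0 \<longleftrightarrow> X = Y"
    using words_eq_imp_subset[of X Y] words_eq_imp_subset[of Y X]
    by (auto simp: subshift_dist_def subshifts_def)
next
  fix X Y Z :: "(int \<Rightarrow> int) set"
  show "subshift_dist X Z \<le> subshift_dist X Y + subshift_dist Y Z"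
  proof (cases "\<forall>n. words n X = words n Z")
    case True then show ?thesis by (simp add: subshift_dist_def)
  next
    case False
    define n where "n = Inf {n. words n X \<noteq> words n Z}"
    have "n \<in> {n. words n X \<noteq> words n Z}"
      unfolding n_def using False by (intro Inf_nat_def1) auto
    then have "words n X \<noteq> words n Y \<or> words n Y \<noteq> words n Z" by auto
    moreover have "1 / 2 ^ n \<le> subshift_dist U V" if uv: "words n U \<noteq> words n V" for U V :: "(int \<Rightarrow> int) set"
    proof -
      have "Inf {n. words n U \<noteq> words n V} \<le> n" using uv by (intro cInf_lower) auto
      then show ?thesis using uv by (auto simp: subshift_dist_def intro!: divide_left_mono power_increasing)
    qed
    moreover have "subshift_dist X Z = 1 / 2 ^ n"
      using False by (simp add: subshift_dist_def n_def)
    moreover have "0 \<le> subshift_dist X Y" "0 \<le> subshift_dist Y Z"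
      by (simp_all add: subshift_dist_def)
    ultimately show ?thesis by (metis add_increasing add_increasing2)
  qed
qed

lemma topspace_minimal_subshift_topology:
  "topspace minimal_subshift_topology = infinite_minimal_subshifts"
proof -
  have "infinite_minimal_subshifts \<subseteq> subshifts"
    by (auto simp: infinite_minimal_subshifts_def subshifts_def minimal_subshift_def)
  then show ?thesis
    by (auto simp: minimal_subshift_topology_def subshift_topology_def
        Metric_space.topspace_mtopology[OF Metric_space_subshifts])
qed

end

theory Submission
  imports Defs
begin

text \<open>
  The dense \<open>G\<^sub>\<delta>\<close> set consists of the infinite minimal subshifts \<open>X\<close> that satisfy two conditions
  for every \<open>n\<close>. Local periodicity of order \<open>n\<close>: some nonempty clopen part of \<open>X\<close> is invariant
  under a power \<open>S\<^sup>p\<close>, and on it \<open>x\<close> and \<open>S\<^sup>p x\<close> agree on \<open>[-n, n]\<close>. Reflection rigidity of order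
  \<open>n\<close>: some \<open>x \<in> X\<close> has the property that no \<open>y \<in> X\<close> takes equal values at \<open>-i\<close> and \<open>-j\<close> whenever
  the words of \<open>x\<close> on \<open>[i-n, i+n]\<close> and \<open>[j-n, j+n]\<close> coincide, where \<open>i\<close>, \<open>j\<close> range over a finite
  interval. Both conditions are decided by the words of \<open>X\<close> of one length and so are open
  (\<open>locally_periodic_open\<close>, \<open>reflection_rigid_open\<close>).

  Local periodicity of all orders is equivalent, for a minimal subshift, to being Toeplitz. In one
  direction a Toeplitz sequence is the limit of nested periodic words
  (\<open>locally_periodic_imp_toeplitz_sequence\<close>); in the other, the points in which a
  central word of a Toeplitz sequence recurs with period \<open>p\<close> form a closed set invariant under
  \<open>S\<^sup>p\<close>, and minimality makes a suitable intersection of translates of it clopen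
  (\<open>toeplitz_imp_locally_periodic\<close>). Reflection rigidity of all orders excludes a conjugacy between
  \<open>S\<close> and its inverse: by the Curtis--Hedlund--Lyndon argument such a conjugacy is a sliding block
  code that reads from right to left, so for some \<open>n\<close> equal words around \<open>i\<close> and \<open>j\<close> yield equal
  letters at \<open>-i\<close> and \<open>-j\<close> (\<open>reversing_map_local\<close>).

  Density is a construction. In an infinite minimal \<open>X\<close> there are words \<open>r\<close>, \<open>s\<close> that lead from an
  occurrence of a fixed word \<open>v\<close> of length \<open>n\<close> to another one and do not commute. Every
  concatenation of the two distinct blocks \<open>rs\<close> and \<open>sr\<close>, which have the same length, then has
  exactly the words of length \<open>n\<close> of \<open>X\<close>, provided that \<open>r\<close> is long
  (\<open>blocks_with_words_of\<close>). Arranging these blocks along a Toeplitz sequence over two letters gives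
  a Toeplitz sequence. The two-letter sequence is the fixed point of the substitution
  \<open>a \<mapsto> 01a011101\<close>. It is chiral: no function of two adjacent letters transforms it into a
  reversed copy of itself (\<open>rigid_seq_chiral\<close>). Being a fixed point, it may be
  read with blocks of \<open>9\<^sup>k\<close> letters for every \<open>k\<close>; with blocks longer than \<open>2n\<close>, a window of radius
  \<open>n\<close> meets at most two adjacent blocks, and chirality of the letters becomes rigidity of order \<open>n\<close>
  of the constructed subshift (\<open>block_expansion_chiral\<close>). Rigidity also shows that the subshift is
  infinite, because a finite minimal subshift is a periodic orbit and hence conjugate to its inverse.
\<close>

section \<open>Sequences that agree on a window\<close>

definition translate :: "int \<Rightarrow> (int \<Rightarrow> 'a) \<Rightarrow> int \<Rightarrow> 'a" where
  "translate k x = (\<lambda>i. x (i + k))"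

definition agree :: "nat \<Rightarrow> (int \<Rightarrow> 'a) \<Rightarrow> (int \<Rightarrow> 'a) \<Rightarrow> bool" where
  "agree n x y \<longleftrightarrow> (\<forall>i. \<bar>i\<bar> \<le> int n \<longrightarrow> x i = y i)"

lemma translate_apply [simp]: "translate k x i = x (i + k)"
  by (simp add: translate_def)

lemma translate_0 [simp]: "translate 0 x = x"
  by (simp add: fun_eq_iff)

lemma translate_translate [simp]: "translate j (translate k x) = translate (j + k) x"
  by (simp add: fun_eq_iff algebra_simps)

lemma shift_eq_translate: "shift = translate 1"
  by (simp add: shift_def fun_eq_iff)

lemma inv_shift_eq_translate: "inv shift = translate (- 1)"
  by (simp add: inv_shift fun_eq_iff)

lemma shift_orbit_eq_translates: "shift_orbit x = range (\<lambda>k. translate k x)"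
  by (auto simp: shift_orbit_def translate_def)

lemma subshift_translate_mem: "subshift X \<Longrightarrow> x \<in> X \<Longrightarrow> translate k x \<in> X"
  unfolding translate_def by (rule subshift_translate)

lemma agreeD: "agree n x y \<Longrightarrow> \<bar>i\<bar> \<le> int n \<Longrightarrow> x i = y i"
  by (simp add: agree_def)

lemma agree_refl [simp]: "agree n x x"
  by (simp add: agree_def)

lemma agree_sym: "agree n x y \<Longrightarrow> agree n y x"
  by (simp add: agree_def)

lemma agree_trans: "agree n x y \<Longrightarrow> agree n y z \<Longrightarrow> agree n x z"
  by (simp add: agree_def)

lemma agree_mono: "agree n x y \<Longrightarrow> m \<le> n \<Longrightarrow> agree m x y"
  by (auto simp: agree_def)

lemma agree_translate:
  assumes "agree n x y" "int m + \<bar>k\<bar> \<le> int n"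
  shows "agree m (translate k x) (translate k y)"
  using assms by (auto simp: agree_def)

lemma open_agree: "open {y :: int \<Rightarrow> int. agree n y x}"
proof -
  have "{y. agree n y x} = (\<Inter>i\<in>{i. \<bar>i\<bar> \<le> int n}. (\<lambda>y. y i) -` {x i})"
    by (auto simp: agree_def)
  moreover have "finite {i. \<bar>i\<bar> \<le> int n}"
    by (rule finite_subset[of _ "{- int n..int n}"]) auto
  moreover have "open ((\<lambda>y :: int \<Rightarrow> int. y i) -` {x i})" for i
    by (rule open_vimage) (auto intro: open_discrete)
  ultimately show ?thesis by (auto intro: open_INT)
qed

lemma closed_agree: "closed {y :: int \<Rightarrow> int. agree n y x}"
proof -
  have "{y. agree n y x} = (\<Inter>i\<in>{i. \<bar>i\<bar> \<le> int n}. (\<lambda>y. y i) -` {x i})"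
    by (auto simp: agree_def)
  moreover have "closed ((\<lambda>y :: int \<Rightarrow> int. y i) -` {x i})" for i
    by (rule closed_vimage) auto
  ultimately show ?thesis by auto
qed

lemma tendsto_agreeI:
  fixes z :: "nat \<Rightarrow> int \<Rightarrow> int"
  assumes "\<And>n. agree n (z n) x"
  shows "z \<longlonglongrightarrow> x"
proof -
  have "(\<lambda>n. z n i) \<longlonglongrightarrow> x i" for i
    by (rule tendsto_eventually)
      (auto simp: eventually_sequentially intro!: exI[of _ "nat \<bar>i\<bar>"] agreeD[OF assms])
  then have "limitin (product_topology (\<lambda>_. euclidean) UNIV) z x sequentially"
    by (simp add: limitin_componentwise)
  then show ?thesis by (simp add: euclidean_product_topology)
qed

lemma closed_agree_mem:
  fixes X :: "(int \<Rightarrow> int) set"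
  assumes "closed X" "\<And>n. \<exists>y\<in>X. agree n y x"
  shows "x \<in> X"
proof -
  obtain z where "\<And>n. z n \<in> X" "\<And>n. agree n (z n) x" using assms(2) by metis
  then show ?thesis using closed_sequentially[OF assms(1)] tendsto_agreeI by blast
qed

lemma mem_closure_iff_agree:
  fixes y :: "int \<Rightarrow> int"
  shows "y \<in> closure S \<longleftrightarrow> (\<forall>n. \<exists>s\<in>S. agree n s y)"
proof
  assume "y \<in> closure S"
  then have "y \<in> {s. agree n s y} \<inter> closure S" for n by simp
  then have "{s. agree n s y} \<inter> S \<noteq> {}" for n
    using open_Int_closure_eq_empty[OF open_agree[of n y], of S] by blast
  then show "\<forall>n. \<exists>s\<in>S. agree n s y" by blast
next
  assume "\<forall>n. \<exists>s\<in>S. agree n s y"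
  then show "y \<in> closure S"
    using closure_subset by (intro closed_agree_mem) blast+
qed

lemma continuous_translate: "continuous_on UNIV (translate k :: (int \<Rightarrow> int) \<Rightarrow> _)"
  unfolding translate_def
  by (intro continuous_on_coordinatewise_then_product continuous_on_product_coordinates)

lemma closed_translate_vimage:
  fixes Y :: "(int \<Rightarrow> int) set"
  assumes "closed Y" shows "closed {x. translate k x \<in> Y}"
  using closed_vimage[OF assms continuous_translate] by (simp add: vimage_def)

lemma closed_finite:
  fixes F :: "(int \<Rightarrow> int) set"
  assumes "finite F" shows "closed F"
proof -
  have "closed {x}" for x :: "int \<Rightarrow> int"
  proof -
    have "{x} = (\<Inter>n. {y. agree n y x})"
      by (auto simp: agree_def fun_eq_iff) (metis int_nat_eq abs_ge_zero order_refl)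
    then show ?thesis by (metis closed_INT closed_agree)
  qed
  then have "closed (\<Union>x\<in>F. {x})" using assms by (intro closed_UN) auto
  then show ?thesis by simp
qed

lemma compact_full_shift:
  assumes "finite A" shows "compact (full_shift A)"
proof -
  have "full_shift A = PiE UNIV (\<lambda>_. A)" by (auto simp: full_shift_def PiE_def)
  moreover have "compactin (product_topology (\<lambda>_. euclidean) UNIV) (PiE UNIV (\<lambda>_::int. A))"
    using assms by (simp add: compactin_PiE finite_imp_compact)
  ultimately show ?thesis by (simp add: euclidean_product_topology)
qed

lemma subshift_compact:
  assumes "subshift X" shows "compact X"
proof -
  obtain A where "finite A" "X \<subseteq> full_shift A"
    using assms by (auto simp: subshift_def dest: closedin_imp_subset)
  then show ?thesis
    using compact_full_shift subshift_closed[OF assms] by (metis compact_Int_closed inf.absorb_iff2)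
qed

text \<open>
  Compactness turns topological separation into a finite radius. Through this lemma, clopen sets and
  continuous functions become conditions on finite words.
\<close>

lemma separated_by_window:
  fixes K L :: "(int \<Rightarrow> int) set"
  assumes K: "compact K" and L: "closed L" and disj: "K \<inter> L = {}"
  shows "\<exists>m. \<forall>x\<in>K. \<forall>y\<in>L. \<not> agree m x y"
proof -
  have "\<exists>n. \<forall>y\<in>L. \<not> agree n y x" if "x \<in> K" for x
    using closed_agree_mem[OF L, of x] that disj by blast
  then obtain n where n: "\<And>x y. x \<in> K \<Longrightarrow> y \<in> L \<Longrightarrow> \<not> agree (n x) y x" by metis
  define U where "U x = {z. agree (n x) z x}" for x
  have op: "open (U x)" for x unfolding U_def by (rule open_agree)
  have "K \<subseteq> (\<Union>x\<in>K. U x)" by (auto simp: U_def)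
  then obtain F where F: "F \<subseteq> K" "finite F" "K \<subseteq> (\<Union>x\<in>F. U x)"
    by (rule compactE_image[OF K op])
  have "\<not> agree (\<Sum>x\<in>F. n x) z y" if zK: "z \<in> K" and yL: "y \<in> L" for z y
  proof
    assume zy: "agree (\<Sum>x\<in>F. n x) z y"
    obtain x where x: "x \<in> F" "agree (n x) z x" using F(3) zK unfolding U_def by blast
    have "n x \<le> (\<Sum>x\<in>F. n x)" using F(2) x(1) by (intro member_le_sum) auto
    then have "agree (n x) y x" using agree_mono[OF zy] x(2) agree_sym agree_trans by blast
    then show False using n F(1) x(1) yL by blast
  qed
  then show ?thesis by blast
qed

section \<open>Minimal subshifts\<close>

lemma minimal_imp_subshift: "minimal_subshift X \<Longrightarrow> subshift X"
  by (simp add: minimal_subshift_def)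

lemma minimal_subshift_iff:
  "minimal_subshift X \<longleftrightarrow>
     subshift X \<and> (\<forall>x\<in>X. \<forall>y\<in>X. \<forall>n. \<exists>k. agree n (translate k x) y)"
proof -
  have "top_of_set X closure_of shift_orbit x = X \<longleftrightarrow> (\<forall>y\<in>X. \<forall>n. \<exists>k. agree n (translate k x) y)"
    if X: "subshift X" and x: "x \<in> X" for x
  proof -
    have "shift_orbit x \<subseteq> X"
      using subshift_translate_mem[OF X x] by (auto simp: shift_orbit_eq_translates)
    then have "X \<inter> shift_orbit x = shift_orbit x" by blast
    then have "top_of_set X closure_of shift_orbit x = X \<inter> closure (shift_orbit x)"
      by (simp add: closure_of_subtopology)
    moreover have "X \<inter> closure (shift_orbit x) = X \<longleftrightarrow> X \<subseteq> closure (shift_orbit x)" by blast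
    moreover have "\<dots> \<longleftrightarrow> (\<forall>y\<in>X. \<forall>n. \<exists>k. agree n (translate k x) y)"
      by (simp add: subset_iff mem_closure_iff_agree shift_orbit_eq_translates Ball_def)
    ultimately show ?thesis by simp
  qed
  then show ?thesis unfolding minimal_subshift_def by blast
qed

lemma minimal_dense:
  "minimal_subshift X \<Longrightarrow> x \<in> X \<Longrightarrow> y \<in> X \<Longrightarrow> \<exists>k. agree n (translate k x) y"
  by (simp add: minimal_subshift_iff)

text \<open>
  Uniform recurrence: the translates of a cylinder cover a minimal subshift, and by compactness
  finitely many of them do.
\<close>

lemma minimal_recurrence:
  assumes X: "minimal_subshift X" and y: "y \<in> X"
  obtains R where "R \<ge> 0" "\<And>x. x \<in> X \<Longrightarrow> \<exists>k. 0 \<le> k \<and> k \<le> R \<and> agree n (translate k x) y"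
proof -
  note sub = minimal_imp_subshift[OF X]
  define U where "U k = {x. agree n (translate k x) y}" for k
  have op: "open (U k)" for k
  proof -
    have "open (translate k -` {x. agree n x y})" by (rule open_vimage[OF open_agree continuous_translate])
    then show ?thesis by (simp add: U_def vimage_def)
  qed
  have "X \<subseteq> (\<Union>k. U k)" using minimal_dense[OF X _ y] by (auto simp: U_def)
  then obtain F where F: "finite F" "X \<subseteq> (\<Union>k\<in>F. U k)"
    by (rule compactE_image[OF subshift_compact[OF sub] op])
  define r where "r = (\<Sum>k\<in>F. \<bar>k\<bar>)"
  have r: "\<bar>k\<bar> \<le> r" if "k \<in> F" for k
    unfolding r_def using F(1) that by (intro member_le_sum) auto
  have r0: "r \<ge> 0" by (simp add: r_def sum_nonneg)
  show thesis
  proof (rule that[of "2 * r"])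
    show "2 * r \<ge> 0" using r0 by simp
    fix x assume "x \<in> X"
    then have "translate r x \<in> X" by (rule subshift_translate_mem[OF sub])
    then obtain k where "k \<in> F" "agree n (translate (k + r) x) y"
      using F(2) by (auto simp: U_def)
    then show "\<exists>k. 0 \<le> k \<and> k \<le> 2 * r \<and> agree n (translate k x) y"
      using r[of k] by (intro exI[of _ "k + r"]) auto
  qed
qed

lemma minimal_invariant_closed:
  assumes X: "minimal_subshift X" and W: "closed W" "W \<subseteq> X" "W \<noteq> {}"
    and inv: "\<And>w k. w \<in> W \<Longrightarrow> translate k w \<in> W"
  shows "W = X"
proof
  show "X \<subseteq> W"
  proof
    fix x assume x: "x \<in> X"
    obtain w where "w \<in> W" using W(3) by blast
    then show "x \<in> W"
      using minimal_dense[OF X _ x] W(2) inv by (intro closed_agree_mem[OF W(1)]) blast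
  qed
qed (rule W(2))

section \<open>The topology of the space of subshifts\<close>

text \<open>
  The common word may sit anywhere in the point of \<open>Y\<close>; shift invariance moves it to the origin.
\<close>

lemma words_window:
  assumes Y: "subshift Y" and sub: "words (2 * n + 1) X \<subseteq> words (2 * n + 1) Y" and x: "x \<in> X"
  shows "\<exists>y\<in>Y. agree n y x"
proof -
  let ?m = "2 * n + 1"
  have "map (\<lambda>j. x (- int n + int j)) [0..<?m] \<in> words ?m X"
    using x unfolding words_def by blast
  then obtain y l where y: "y \<in> Y"
    and w: "map (\<lambda>j. x (- int n + int j)) [0..<?m] = map (\<lambda>j. y (l + int j)) [0..<?m]"
    using sub unfolding words_def by blast
  have ag: "x (- int n + int j) = y (l + int j)" if "j < ?m" for j
    using arg_cong[OF w, of "\<lambda>xs. xs ! j"] that by (simp del: upt_Suc)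
  have "agree n (translate (l + int n) y) x"
    unfolding agree_def
  proof (intro allI impI)
    fix i :: int assume i: "\<bar>i\<bar> \<le> int n"
    have m: "nat (i + int n) < ?m" and c: "int (nat (i + int n)) = i + int n" using i by auto
    show "translate (l + int n) y i = x i" using ag[OF m] unfolding c by (simp add: algebra_simps)
  qed
  then show ?thesis using subshift_translate_mem[OF Y y] by blast
qed

lemma words_eq_take:
  assumes "m \<le> n" shows "words m X = take m ` words n X"
proof -
  have "take m (map f [0..<n]) = map f [0..<m]" for f :: "nat \<Rightarrow> 'a"
    using assms by (simp add: take_map)
  then show ?thesis by (force simp: words_def image_def)
qed

lemma words_eq_antimono: "words n X = words n Y \<Longrightarrow> m \<le> n \<Longrightarrow> words m X = words m Y"
  by (simp add: words_eq_take)

lemma subshift_dist_less_iff: "subshift_dist X Y < 1 / 2 ^ n \<longleftrightarrow> words n X = words n Y"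
proof (cases "\<forall>n. words n X = words n Y")
  case True then show ?thesis by (simp add: subshift_dist_def)
next
  case False
  define k where "k = Inf {n. words n X \<noteq> words n Y}"
  have k: "words k X \<noteq> words k Y"
    using Inf_nat_def1[of "{n. words n X \<noteq> words n Y}"] False unfolding k_def by auto
  have "words n X = words n Y \<longleftrightarrow> n < k"
  proof
    assume "words n X = words n Y"
    then show "n < k" using k words_eq_antimono by (metis not_le)
  next
    have "k \<le> n" if "words n X \<noteq> words n Y" unfolding k_def using that by (intro cInf_lower) auto
    then show "n < k \<Longrightarrow> words n X = words n Y" by force
  qed
  moreover have "subshift_dist X Y = 1 / 2 ^ k" using False by (simp add: subshift_dist_def k_def)
  moreover have "1 / 2 ^ k < (1 / 2 ^ n :: real) \<longleftrightarrow> (2::real) ^ n < 2 ^ k" by (simp add: field_simps)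
  ultimately show ?thesis by simp
qed

lemma openin_subshift_topology_iff:
  "openin subshift_topology U \<longleftrightarrow>
     U \<subseteq> subshifts \<and> (\<forall>X\<in>U. \<exists>n. \<forall>Y\<in>subshifts. words n X = words n Y \<longrightarrow> Y \<in> U)"
proof -
  interpret Metric_space subshifts subshift_dist by (rule Metric_space_subshifts)
  have "(\<exists>r>0. mball X r \<subseteq> U) \<longleftrightarrow> (\<exists>n. \<forall>Y\<in>subshifts. words n X = words n Y \<longrightarrow> Y \<in> U)"
    if "X \<in> subshifts" for X
  proof
    assume "\<exists>r>0. mball X r \<subseteq> U"
    then obtain r where r: "r > 0" "mball X r \<subseteq> U" by blast
    obtain n where "1 / 2 ^ n < r" using real_arch_pow_inv[OF r(1), of "1/2"] by (auto simp: power_divide)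
    then have "Y \<in> U" if "Y \<in> subshifts" "words n X = words n Y" for Y
      using r(2) that \<open>X \<in> subshifts\<close> subshift_dist_less_iff[of X Y n] by (auto simp: subset_iff)
    then show "\<exists>n. \<forall>Y\<in>subshifts. words n X = words n Y \<longrightarrow> Y \<in> U" by blast
  next
    assume "\<exists>n. \<forall>Y\<in>subshifts. words n X = words n Y \<longrightarrow> Y \<in> U"
    then obtain n where "\<forall>Y\<in>subshifts. words n X = words n Y \<longrightarrow> Y \<in> U" by blast
    then have "mball X (1 / 2 ^ n) \<subseteq> U" by (auto simp: subshift_dist_less_iff)
    then show "\<exists>r>0. mball X r \<subseteq> U" by (intro exI[of _ "1 / 2 ^ n"]) auto
  qed
  then show ?thesis unfolding subshift_topology_def openin_mtopology by blast
qed

lemma infinite_minimal_subset_subshifts: "infinite_minimal_subshifts \<subseteq> subshifts"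
  by (auto simp: infinite_minimal_subshifts_def subshifts_def minimal_subshift_def)

lemma openin_minimal_subshift_topologyI:
  assumes U: "U \<subseteq> infinite_minimal_subshifts"
    and loc: "\<And>X. X \<in> U \<Longrightarrow> \<exists>n. \<forall>Y\<in>infinite_minimal_subshifts. words n X = words n Y \<longrightarrow> Y \<in> U"
  shows "openin minimal_subshift_topology U"
proof -
  define n where "n X = (SOME n. \<forall>Y\<in>infinite_minimal_subshifts. words n X = words n Y \<longrightarrow> Y \<in> U)" for X
  have n: "Y \<in> U" if "X \<in> U" "Y \<in> infinite_minimal_subshifts" "words (n X) X = words (n X) Y" for X Y
    using someI_ex[OF loc[OF that(1)]] that(2,3) unfolding n_def by blast
  define T where "T = {Y \<in> subshifts. \<exists>X\<in>U. words (n X) X = words (n X) Y}"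
  have "openin subshift_topology T"
    unfolding openin_subshift_topology_iff
  proof (intro conjI ballI)
    fix Y assume "Y \<in> T"
    then obtain X where "X \<in> U" "words (n X) X = words (n X) Y" by (auto simp: T_def)
    then show "\<exists>n. \<forall>Z\<in>subshifts. words n Y = words n Z \<longrightarrow> Z \<in> T"
      by (intro exI[of _ "n X"]) (auto simp: T_def)
  qed (auto simp: T_def)
  moreover have "U = T \<inter> infinite_minimal_subshifts"
    using n U infinite_minimal_subset_subshifts by (fastforce simp: T_def)
  ultimately show ?thesis unfolding minimal_subshift_topology_def openin_subtopology by blast
qed

lemma dense_in_minimal_subshift_topologyI:
  assumes G: "G \<subseteq> infinite_minimal_subshifts"
    and dense: "\<And>X n. X \<in> infinite_minimal_subshifts \<Longrightarrow> \<exists>Y\<in>G. words n X = words n Y"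
  shows "minimal_subshift_topology closure_of G = topspace minimal_subshift_topology"
proof (intro equalityI closure_of_subset_topspace subsetI)
  fix X assume X: "X \<in> topspace minimal_subshift_topology"
  have "\<exists>Y. Y \<in> G \<and> Y \<in> T" if T: "X \<in> T" "openin minimal_subshift_topology T" for T
  proof -
    obtain S where S: "openin subshift_topology S" "T = S \<inter> infinite_minimal_subshifts"
      using T(2) unfolding minimal_subshift_topology_def openin_subtopology by blast
    obtain n where n: "\<forall>Y\<in>subshifts. words n X = words n Y \<longrightarrow> Y \<in> S"
      using S(1) S(2) T(1) unfolding openin_subshift_topology_iff by blast
    obtain Y where "Y \<in> G" "words n X = words n Y"
      using dense X topspace_minimal_subshift_topology by blast
    then show ?thesis using n S(2) G infinite_minimal_subset_subshifts by blast
  qed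
  then show "X \<in> minimal_subshift_topology closure_of G"
    using X by (simp add: in_closure_of)
qed

definition window :: "nat \<Rightarrow> (int \<Rightarrow> 'a) \<Rightarrow> int \<Rightarrow> 'a list" where
  "window n x i = map (\<lambda>j. x (i + int j)) [0..<n]"

lemma words_eq_windows: "words n X = {window n x i | x i. x \<in> X}"
  by (simp add: words_def window_def)

lemma window_cong:
  assumes "\<And>j. 0 \<le> j \<Longrightarrow> j < int n \<Longrightarrow> x (i + j) = y (k + j)"
  shows "window n x i = window n y k"
  using assms by (simp add: window_def)

section \<open>Two conditions on finitely many words\<close>

text \<open>
  The set \<open>V\<close> represents a clopen subset of \<open>X\<close>. Membership in it is tied to a window of radius \<open>m\<close>
  for sequences outside \<open>X\<close> too, so that the same \<open>V\<close> can be used for subshifts near \<open>X\<close>.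
\<close>

definition locally_periodic :: "nat \<Rightarrow> (int \<Rightarrow> int) set \<Rightarrow> bool" where
  "locally_periodic n X \<longleftrightarrow>
     (\<exists>p\<ge>1. \<exists>m V. X \<inter> V \<noteq> {} \<and> (\<forall>x y. agree m x y \<longrightarrow> x \<in> V \<longrightarrow> y \<in> V) \<and>
        (\<forall>x\<in>X \<inter> V. translate p x \<in> V \<and> translate (- p) x \<in> V \<and> agree n (translate p x) x))"

text \<open>
  The pairs \<open>i\<close>, \<open>j\<close> are positions around which \<open>x\<close> shows the same word of radius \<open>n\<close>. A code of
  radius \<open>n\<close> that reverses the direction would give \<open>x\<close> an image with equal letters at \<open>-i\<close> and
  \<open>-j\<close>. The condition excludes every candidate \<open>y\<close> for this image, whatever the code.
\<close>

definition reflection_rigid :: "nat \<Rightarrow> (int \<Rightarrow> int) set \<Rightarrow> bool" where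
  "reflection_rigid n X \<longleftrightarrow>
     (\<exists>x\<in>X. \<exists>m. \<forall>y\<in>X. \<exists>i j. \<bar>i\<bar> \<le> int m \<and> \<bar>j\<bar> \<le> int m \<and>
        agree n (translate i x) (translate j x) \<and> y (- i) \<noteq> y (- j))"

text \<open>
  A point of a nearby subshift agrees with a point of \<open>X\<close> on a window that contains all the
  coordinates on which the defining condition depends: those deciding membership in \<open>V\<close> before and
  after the translation by \<open>p\<close>, and those compared between \<open>x\<close> and its translate.
\<close>

lemma locally_periodic_open:
  assumes X: "subshift X" and per: "locally_periodic n X"
  shows "\<exists>N. \<forall>Y. subshift Y \<longrightarrow> words N X = words N Y \<longrightarrow> locally_periodic n Y"
proof -
  obtain p m V where p: "p \<ge> 1" and ne: "X \<inter> V \<noteq> {}"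
    and V: "\<And>x y. agree m x y \<Longrightarrow> x \<in> V \<Longrightarrow> y \<in> V"
    and step: "\<And>x. x \<in> X \<inter> V \<Longrightarrow> translate p x \<in> V \<and> translate (- p) x \<in> V \<and> agree n (translate p x) x"
    using per unfolding locally_periodic_def by metis
  define N where "N = m + n + nat p"
  have "locally_periodic n Y" if Y: "subshift Y" and w: "words (2 * N + 1) X = words (2 * N + 1) Y" for Y
  proof -
    have "\<exists>y\<in>Y. y \<in> V"
    proof -
      obtain x where "x \<in> X" "x \<in> V" using ne by blast
      moreover obtain y where "y \<in> Y" "agree N y x" using words_window[OF Y] w \<open>x \<in> X\<close> by blast
      moreover have "agree m x y" using \<open>agree N y x\<close> by (auto intro: agree_sym agree_mono simp: N_def)
      ultimately show ?thesis using V by blast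
    qed
    moreover have "translate p y \<in> V \<and> translate (- p) y \<in> V \<and> agree n (translate p y) y"
      if y: "y \<in> Y \<inter> V" for y
    proof -
      obtain x where x: "x \<in> X" "agree N x y" using words_window[OF X _ IntD1[OF y]] w by blast
      have "agree m y x" by (rule agree_sym, rule agree_mono[OF x(2)]) (simp add: N_def)
      then have "x \<in> V" using V y by blast
      then have s: "translate p x \<in> V" "translate (- p) x \<in> V" "agree n (translate p x) x"
        using step x(1) by auto
      have "agree m (translate p x) (translate p y)" "agree m (translate (- p) x) (translate (- p) y)"
        "agree n (translate p x) (translate p y)"
        using p by (auto intro!: agree_translate[OF x(2)] simp: N_def)
      moreover have "agree n x y" using x(2) by (rule agree_mono) (simp add: N_def)
      ultimately show ?thesis
        using V[OF _ s(1)] V[OF _ s(2)] agree_trans[OF agree_sym agree_trans[OF s(3)]] by blast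
    qed
    ultimately have "Y \<inter> V \<noteq> {}"
      "\<forall>y\<in>Y \<inter> V. translate p y \<in> V \<and> translate (- p) y \<in> V \<and> agree n (translate p y) y"
      by blast+
    then show ?thesis
      unfolding locally_periodic_def using p V by (intro exI[of _ p] conjI exI[of _ m] exI[of _ V]) auto
  qed
  then show ?thesis by blast
qed

text \<open>
  Both the witness \<open>x\<close> and the competitors \<open>y\<close> enter the condition only through a bounded window.
\<close>

lemma reflection_rigid_open:
  assumes X: "subshift X" and rigid: "reflection_rigid n X"
  shows "\<exists>N. \<forall>Y. subshift Y \<longrightarrow> words N X = words N Y \<longrightarrow> reflection_rigid n Y"
proof -
  obtain x m where x: "x \<in> X" and m: "\<And>y. y \<in> X \<Longrightarrow> \<exists>i j. \<bar>i\<bar> \<le> int m \<and> \<bar>j\<bar> \<le> int m \<and>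
        agree n (translate i x) (translate j x) \<and> y (- i) \<noteq> y (- j)"
    using rigid unfolding reflection_rigid_def by blast
  define N where "N = m + n"
  have "reflection_rigid n Y" if Y: "subshift Y" and w: "words (2 * N + 1) X = words (2 * N + 1) Y" for Y
  proof -
    obtain x' where x': "x' \<in> Y" "agree N x' x" using words_window[OF Y] w x by blast
    have "\<exists>i j. \<bar>i\<bar> \<le> int m \<and> \<bar>j\<bar> \<le> int m \<and>
        agree n (translate i x') (translate j x') \<and> y (- i) \<noteq> y (- j)" if y: "y \<in> Y" for y
    proof -
      obtain y' where y': "y' \<in> X" "agree N y' y" using words_window[OF X _ y] w by blast
      obtain i j where ij: "\<bar>i\<bar> \<le> int m" "\<bar>j\<bar> \<le> int m" "agree n (translate i x) (translate j x)"
        "y' (- i) \<noteq> y' (- j)" using m[OF y'(1)] by blast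
      have "y' (- i) = y (- i)" "y' (- j) = y (- j)"
        using ij(1,2) by (auto intro!: agreeD[OF y'(2)] simp: N_def)
      moreover have "agree n (translate i x') (translate i x)" "agree n (translate j x') (translate j x)"
        using ij(1,2) by (auto intro!: agree_translate[OF x'(2)] simp: N_def)
      ultimately have "y (- i) \<noteq> y (- j)" "agree n (translate i x') (translate j x')"
        using ij(4) agree_trans[OF _ agree_trans[OF ij(3) agree_sym]] by auto
      then show ?thesis using ij(1,2) by blast
    qed
    then show ?thesis using x'(1) unfolding reflection_rigid_def by blast
  qed
  then show ?thesis by blast
qed

section \<open>Local periodicity and Toeplitz sequences\<close>

lemma locally_periodic_orbit:
  assumes X: "subshift X"
    and step: "\<And>x. x \<in> X \<inter> V \<Longrightarrow> translate p x \<in> V \<and> translate (- p) x \<in> V \<and> agree n (translate p x) x"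
    and x: "x \<in> X \<inter> V"
  shows "agree n (translate (k * p) x) x"
proof -
  have "translate (k * p) x \<in> V \<and> agree n (translate (k * p) x) x"
  proof (induction k rule: int_induct[of _ 0])
    case base then show ?case using x by simp
  next
    case (step1 k)
    have mem: "translate (k * p) x \<in> X \<inter> V"
      using step1 subshift_translate_mem[OF X] x by blast
    have "translate p (translate (k * p) x) = translate ((k + 1) * p) x" by (simp add: algebra_simps)
    then show ?case using step[OF mem] step1 agree_trans by metis
  next
    case (step2 k)
    have mem: "translate (k * p) x \<in> X \<inter> V"
      using step2 subshift_translate_mem[OF X] x by blast
    have e: "translate (- p) (translate (k * p) x) = translate ((k - 1) * p) x" by (simp add: algebra_simps)
    have V: "translate ((k - 1) * p) x \<in> V" using step[OF mem] e by simp
    have "agree n (translate p (translate ((k - 1) * p) x)) (translate ((k - 1) * p) x)"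
      using step[of "translate ((k - 1) * p) x"] V subshift_translate_mem[OF X] x by blast
    then have "agree n (translate (k * p) x) (translate ((k - 1) * p) x)" by (simp add: algebra_simps)
    then show ?case using V step2 agree_sym agree_trans by metis
  qed
  then show ?thesis by blast
qed

text \<open>
  One step towards a Toeplitz sequence: any central word of \<open>X\<close> can be extended to a longer one
  that forces periodicity on \<open>[-n, n]\<close>. A point of the periodic clopen set contains the word at a
  position between \<open>0\<close> and \<open>R\<close>, so the periodic stretch is taken longer by \<open>R\<close> than needed and
  still covers \<open>[-n, n]\<close> after this position is moved to the origin.
\<close>

lemma locally_periodic_extend:
  assumes X: "minimal_subshift X" and per: "\<And>n. locally_periodic n X" and x: "x \<in> X"
  shows "\<exists>y\<in>X. agree a y x \<and> (\<exists>b. \<forall>z\<in>X. agree b z y \<longrightarrow>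
           (\<exists>p\<ge>1. \<forall>i k. \<bar>i\<bar> \<le> int n \<longrightarrow> z (i + k * p) = z i))"
proof -
  note sub = minimal_imp_subshift[OF X]
  obtain R where R: "R \<ge> 0" "\<And>y. y \<in> X \<Longrightarrow> \<exists>k. 0 \<le> k \<and> k \<le> R \<and> agree a (translate k y) x"
    using minimal_recurrence[OF X x] by metis
  define N where "N = n + nat R"
  obtain p m V where p: "p \<ge> 1" and ne: "X \<inter> V \<noteq> {}"
    and V: "\<And>x y. agree m x y \<Longrightarrow> x \<in> V \<Longrightarrow> y \<in> V"
    and step: "\<And>x. x \<in> X \<inter> V \<Longrightarrow> translate p x \<in> V \<and> translate (- p) x \<in> V \<and> agree N (translate p x) x"
    using per[of N] unfolding locally_periodic_def by metis
  obtain v where v: "v \<in> X" "v \<in> V" using ne by blast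
  obtain k where k: "0 \<le> k" "k \<le> R" "agree a (translate k v) x" using R(2)[OF v(1)] by blast
  have "\<exists>p\<ge>1. \<forall>i l. \<bar>i\<bar> \<le> int n \<longrightarrow> z (i + l * p) = z i"
    if z: "z \<in> X" "agree (m + nat k) z (translate k v)" for z
  proof (intro exI[of _ p] conjI p allI impI)
    fix i l :: int assume i: "\<bar>i\<bar> \<le> int n"
    have "agree m (translate (- k) z) (translate (- k) (translate k v))"
      using k(1) by (intro agree_translate[OF z(2)]) auto
    then have "agree m v (translate (- k) z)" by (simp add: agree_sym)
    then have "translate (- k) z \<in> V" using V v(2) by blast
    then have "agree N (translate (l * p) (translate (- k) z)) (translate (- k) z)"
      using subshift_translate_mem[OF sub z(1)] by (intro locally_periodic_orbit[OF sub step]) auto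
    from agreeD[OF this, of "i + k"] show "z (i + l * p) = z i"
      using i k(1,2) by (simp add: N_def algebra_simps)
  qed
  then show ?thesis
    using subshift_translate_mem[OF sub v(1)] k(3) by (intro bexI[of _ "translate k v"] conjI exI[of _ "m + nat k"]) auto
qed

text \<open>
  The preceding extension is iterated, asking for a longer periodic stretch at each step. The limit of
  the nested words is periodic at each single position, with a period that depends on it.
\<close>

lemma locally_periodic_imp_toeplitz_sequence:
  assumes X: "minimal_subshift X" "X \<noteq> {}" and per: "\<And>n. locally_periodic n X"
  shows "\<exists>x\<in>X. toeplitz_sequence x"
proof -
  note sub = minimal_imp_subshift[OF X(1)]
  define P where "P n z \<longleftrightarrow> (\<exists>p\<ge>1. \<forall>i k. \<bar>i\<bar> \<le> int n \<longrightarrow> z (i + k * p) = z i)" for n :: nat and z :: "int \<Rightarrow> int"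
  \<comment> \<open>A state is a point together with the radius of the window that later steps must preserve.\<close>
  define Q where "Q n s \<longleftrightarrow> fst s \<in> X \<and> n \<le> snd s \<and> (\<forall>z\<in>X. agree (snd s) z (fst s) \<longrightarrow> P n z)" for n s
  have ext: "\<exists>s. Q n s \<and> a \<le> snd s \<and> agree a (fst s) x" if x: "x \<in> X" for n a x
  proof -
    obtain y b where y: "y \<in> X" "agree a y x" and b: "\<forall>z\<in>X. agree b z y \<longrightarrow> P n z"
      using locally_periodic_extend[OF X(1) per x, of a n] unfolding P_def by blast
    have "P n z" if "z \<in> X" "agree (b + n + a) z y" for z
      using b that agree_mono[of "b + n + a" z y b] by simp
    then show ?thesis
      using y by (intro exI[of _ "(y, b + n + a)"]) (simp add: Q_def)
  qed
  have "\<exists>f. \<forall>n. Q n (f n) \<and> (snd (f n) \<le> snd (f (Suc n)) \<and> agree (snd (f n)) (fst (f (Suc n))) (fst (f n)))"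
  proof (rule dependent_nat_choice)
    show "\<exists>s. Q 0 s" using ext X(2) by blast
    fix s n assume "Q n s"
    then show "\<exists>t. Q (Suc n) t \<and> (snd s \<le> snd t \<and> agree (snd s) (fst t) (fst s))"
      using ext by (simp add: Q_def)
  qed
  then obtain f where f: "\<And>n. Q n (f n)" "\<And>n. snd (f n) \<le> snd (f (Suc n))"
    "\<And>n. agree (snd (f n)) (fst (f (Suc n))) (fst (f n))" by blast
  define g where "g n = fst (f n)" for n
  define b where "b n = snd (f n)" for n
  have b: "n \<le> b n" for n using f(1)[of n] by (simp add: Q_def b_def)
  have bmono: "b n \<le> b (n + d)" for n d
    using lift_Suc_mono_le[of b n "n + d"] f(2) by (simp add: b_def)
  have gg: "agree (b n) (g (n + d)) (g n)" for n d
  proof (induction d)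
    case (Suc d)
    have "agree (b n) (g (Suc (n + d))) (g (n + d))"
      using f(3)[of "n + d"] bmono[of n d] unfolding g_def b_def by (rule agree_mono)
    then show ?case using Suc agree_trans by simp
  qed simp
  define x where "x i = g (nat \<bar>i\<bar>) i" for i
  have xg: "agree (b n) x (g n)" for n
    unfolding agree_def
  proof (intro allI impI)
    fix i :: int assume i: "\<bar>i\<bar> \<le> int (b n)"
    show "x i = g n i"
    proof (cases "nat \<bar>i\<bar> \<le> n")
      case True
      then have "agree (b (nat \<bar>i\<bar>)) (g n) (g (nat \<bar>i\<bar>))"
        using gg[of "nat \<bar>i\<bar>" "n - nat \<bar>i\<bar>"] by simp
      then show ?thesis using b[of "nat \<bar>i\<bar>"] by (simp add: x_def agree_def)
    next
      case False
      then have "agree (b n) (g (nat \<bar>i\<bar>)) (g n)"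
        using gg[of n "nat \<bar>i\<bar> - n"] by simp
      then show ?thesis using i by (simp add: x_def agree_def)
    qed
  qed
  have gX: "g n \<in> X" for n using f(1)[of n] by (simp add: Q_def g_def)
  have "x \<in> X"
    using gX xg b by (intro closed_agree_mem[OF subshift_closed[OF sub]]) (meson agree_mono agree_sym)
  moreover from this have "P n x" for n
    using f(1)[of n] xg[of n] by (simp add: Q_def g_def b_def)
  then have "toeplitz_sequence x"
    unfolding toeplitz_sequence_def P_def
    by (metis abs_of_nonneg int_nat_eq abs_ge_zero order_refl)
  ultimately show ?thesis by blast
qed

text \<open>
  For \<open>x \<in> X\<close> let \<open>J x\<close> be the set of residues \<open>i\<close> modulo \<open>p\<close> with \<open>S\<^sup>i x \<in> Y\<close>; translating \<open>x\<close>
  rotates \<open>J x\<close>. The points with a fixed \<open>J x = I\<close> of the largest possible size form a closed set,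
  since \<open>I \<subseteq> J x\<close> already implies equality. The translates of this set are pairwise equal or
  disjoint, there are at most \<open>p\<close> of them, and by minimality they cover \<open>X\<close>; so each is clopen.
\<close>

lemma periodic_closed_contains_clopen:
  fixes p :: int
  assumes X: "minimal_subshift X" and Y: "closed Y" "Y \<subseteq> X" "Y \<noteq> {}" and p: "p \<ge> 1"
    and inv: "\<And>y. y \<in> Y \<Longrightarrow> translate p y \<in> Y" "\<And>y. y \<in> Y \<Longrightarrow> translate (- p) y \<in> Y"
  shows "\<exists>Z\<subseteq>Y. Z \<noteq> {} \<and> closed Z \<and> closed (X - Z) \<and> (\<forall>z\<in>Z. translate p z \<in> Z \<and> translate (- p) z \<in> Z)"
proof -
  note sub = minimal_imp_subshift[OF X]
  have power: "translate (k * p) y \<in> Y" if "y \<in> Y" for k y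
  proof (induction k rule: int_induct[of _ 0])
    case (step1 k)
    have "translate p (translate (k * p) y) = translate ((k + 1) * p) y" by (simp add: algebra_simps)
    then show ?case using inv(1)[OF step1(2)] by (simp only:)
  next
    case (step2 k)
    have "translate (- p) (translate (k * p) y) = translate ((k - 1) * p) y" by (simp add: algebra_simps)
    then show ?case using inv(2)[OF step2(2)] by (simp only:)
  qed (simp add: that)
  have mod: "translate i x \<in> Y \<longleftrightarrow> translate (i mod p) x \<in> Y" for i x
  proof -
    have "i = (i div p) * p + i mod p" by simp
    then have "translate i x = translate ((i div p) * p) (translate (i mod p) x)"
      "translate (i mod p) x = translate (- (i div p) * p) (translate i x)"
      by (simp_all add: algebra_simps minus_mult_div_eq_mod)
    then show ?thesis using power by metis
  qed
  define J where "J x = {i \<in> {0..<p}. translate i x \<in> Y}" for x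
  have J_sub: "J x \<subseteq> {0..<p}" for x by (auto simp: J_def)
  then have J_fin: "finite (J x)" for x using finite_subset by blast
  have J_iff: "i mod p \<in> J x \<longleftrightarrow> translate i x \<in> Y" for i x
    using mod p by (simp add: J_def)
  have J_translate: "J x = (\<lambda>i. (i + k) mod p) ` J (translate k x)" for k x
  proof (intro equalityI subsetI)
    fix i assume i: "i \<in> J x"
    then have "((i - k) mod p + k) mod p = i" using J_sub[of x] by (auto simp: mod_simps)
    moreover have "(i - k) mod p \<in> J (translate k x)"
      using i by (simp add: J_iff) (simp add: J_def)
    ultimately show "i \<in> (\<lambda>i. (i + k) mod p) ` J (translate k x)" by force
  qed (auto simp: J_iff, simp add: J_def)
  have J_card: "card (J (translate k x)) = card (J x)" for k x
  proof -
    have "inj_on (\<lambda>i. (i + k) mod p) {0..<p}"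
    proof (rule inj_onI)
      fix i j assume ij: "i \<in> {0..<p}" "j \<in> {0..<p}" "(i + k) mod p = (j + k) mod p"
      then have "(i + k - k) mod p = (j + k - k) mod p" by (metis mod_diff_left_eq)
      then show "i = j" using ij(1,2) by simp
    qed
    then show ?thesis
      using J_translate[of x k] J_sub[of "translate k x"] by (metis card_image inj_on_subset)
  qed
  obtain y0 where y0: "y0 \<in> Y" using Y(3) by blast
  have "card (J x) \<le> card {0..<p}" for x by (rule card_mono[OF _ J_sub]) simp
  then have "\<exists>x. x \<in> X \<and> (\<forall>y. y \<in> X \<longrightarrow> card (J y) \<le> card (J x))"
    using y0 Y(2) by (intro ex_has_greatest_nat[of _ y0 _ "card {0..<p} + 1"]) (auto simp: less_Suc_eq_le)
  then obtain x0 where x0: "x0 \<in> X" "\<And>y. y \<in> X \<Longrightarrow> card (J y) \<le> card (J x0)" by blast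
  have "0 \<in> J y0" using y0 p by (simp add: J_def)
  then have "card (J y0) > 0" using J_fin card_gt_0_iff by blast
  then have "J x0 \<noteq> {}" using x0(2)[of y0] y0 Y(2) by force
  then obtain i0 where i0: "i0 \<in> J x0" by blast
  define x1 where "x1 = translate i0 x0"
  have x1: "x1 \<in> X" "\<And>y. y \<in> X \<Longrightarrow> card (J y) \<le> card (J x1)" "0 \<in> J x1"
    using subshift_translate_mem[OF sub x0(1)] x0(2) J_card i0 p by (auto simp: x1_def J_def)
  define I where "I = J x1"
  have maximal: "J x = I" if "x \<in> X" "I \<subseteq> J x" for x
    using that x1(2)[OF that(1)] J_fin unfolding I_def by (metis card_seteq)
  define Z where "Z = {x \<in> X. J x = I}"
  have Z_eq: "Z = X \<inter> (\<Inter>i\<in>I. {x. translate i x \<in> Y})"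
    using maximal J_sub unfolding Z_def by (auto simp: J_def I_def)
  have closed_Z: "closed Z"
    unfolding Z_eq using Y(1) by (intro closed_Int subshift_closed[OF sub] closed_INT ballI closed_translate_vimage)
  have J_mod: "J (translate k x) = J (translate l x)" if "k mod p = l mod p" for k l x
  proof -
    have "(i + k) mod p = (i + l) mod p" for i using that by (metis mod_add_right_eq)
    then show ?thesis using mod[of "_ + k" x] mod[of "_ + l" x] by (simp add: J_def)
  qed
  have J_p: "J (translate p x) = J x" "J (translate (- p) x) = J x" for x
    using J_mod[of p 0 x] J_mod[of "- p" 0 x] by simp_all
  define W where "W k = {x \<in> X. translate k x \<in> Z}" for k
  have closed_W: "closed (W k)" for k
  proof -
    have "W k = X \<inter> {x. translate k x \<in> Z}" by (auto simp: W_def)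
    then show ?thesis
      using closed_Int[OF subshift_closed[OF sub] closed_translate_vimage[OF closed_Z]] by simp
  qed
  have W_mod: "W k = W (k mod p)" for k
    using J_mod[of k "k mod p"] subshift_translate_mem[OF sub] by (simp add: W_def Z_def cong: conj_cong)
  have cover: "(\<Union>k\<in>{0..<p}. W k) = X"
  proof (rule minimal_invariant_closed[OF X])
    show "closed (\<Union>k\<in>{0..<p}. W k)" by (intro closed_UN ballI closed_W) simp
    show "(\<Union>k\<in>{0..<p}. W k) \<subseteq> X" by (auto simp: W_def)
    have "x1 \<in> W 0" using x1 by (simp add: W_def Z_def I_def)
    then show "(\<Union>k\<in>{0..<p}. W k) \<noteq> {}" using p by force
    fix x j assume "x \<in> (\<Union>k\<in>{0..<p}. W k)"
    then obtain k where "x \<in> W k" by blast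
    then have "translate j x \<in> W (k - j)"
      using subshift_translate_mem[OF sub] by (simp add: W_def)
    then have "translate j x \<in> W ((k - j) mod p)" using W_mod by simp
    moreover have "(k - j) mod p \<in> {0..<p}" using p by simp
    ultimately show "translate j x \<in> (\<Union>k\<in>{0..<p}. W k)" by blast
  qed
  have meets: "W k \<subseteq> Z" if "W k \<inter> Z \<noteq> {}" for k
  proof
    obtain x where x: "J x = I" "J (translate k x) = I" using \<open>W k \<inter> Z \<noteq> {}\<close> by (auto simp: W_def Z_def)
    fix x' assume "x' \<in> W k"
    then have x': "x' \<in> X" "J (translate k x') = I" by (auto simp: W_def Z_def)
    then have "J x' = I" using J_translate[of x' k] J_translate[of x k] x by simp
    then show "x' \<in> Z" using x'(1) by (simp add: Z_def)
  qed
  have "X - Z = (\<Union>k\<in>{k \<in> {0..<p}. W k \<inter> Z = {}}. W k)"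
    using cover meets by blast
  moreover have "closed (\<Union>k\<in>{k \<in> {0..<p}. W k \<inter> Z = {}}. W k)"
    by (rule closed_UN[OF finite_subset[of _ "{0..<p}"]]) (auto simp: closed_W)
  ultimately have "closed (X - Z)" by (simp only:)
  moreover have "Z \<subseteq> Y"
  proof
    fix x assume "x \<in> Z"
    then have "0 \<in> J x" using x1(3) by (simp add: Z_def I_def)
    then show "x \<in> Y" by (simp add: J_def)
  qed
  moreover have "Z \<noteq> {}" using x1(1) by (auto simp: Z_def I_def)
  moreover have "\<forall>z\<in>Z. translate p z \<in> Z \<and> translate (- p) z \<in> Z"
    using J_p subshift_translate_mem[OF sub] by (auto simp: Z_def)
  ultimately show ?thesis using closed_Z by blast
qed

lemma toeplitz_window_period:
  fixes x :: "int \<Rightarrow> 'a"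
  assumes "toeplitz_sequence x"
  obtains p where "p \<ge> 1" "\<And>k. agree n (translate (k * p) x) x"
proof -
  obtain q where q: "\<And>i. q i \<ge> 1" "\<And>i k. x i = x (i + k * q i)"
    using assms unfolding toeplitz_sequence_def by metis
  define p where "p = (\<Prod>i\<in>{- int n..int n}. q i)"
  have "x (i + k * p) = x i" if "\<bar>i\<bar> \<le> int n" for i k
  proof -
    have "q i dvd p" unfolding p_def using that by (intro dvd_prodI) auto
    then obtain r where "p = q i * r" by blast
    then show ?thesis using q(2)[of i "k * r"] by (simp add: algebra_simps)
  qed
  then have "agree n (translate (k * p) x) x" for k by (simp add: agree_def)
  moreover have "p \<ge> 1" unfolding p_def by (intro prod_ge_1 q)
  ultimately show thesis using that by blast
qed

text \<open>
  The points that show the central word of the Toeplitz sequence at all multiples of a period \<open>p\<close>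
  form a closed set invariant under \<open>S\<^sup>p\<close>, and \<open>periodic_closed_contains_clopen\<close> finds the required
  clopen set inside it.
\<close>

lemma toeplitz_imp_locally_periodic:
  assumes X: "minimal_subshift X" and x: "x \<in> X" "toeplitz_sequence x"
  shows "locally_periodic n X"
proof -
  note sub = minimal_imp_subshift[OF X]
  obtain p where p: "p \<ge> 1" "\<And>k. agree n (translate (k * p) x) x"
    using toeplitz_window_period[OF x(2)] by metis
  define Y where "Y = {y \<in> X. \<forall>k. agree n (translate (k * p) y) x}"
  have "Y = X \<inter> (\<Inter>k. {y. translate (k * p) y \<in> {y. agree n y x}})" by (auto simp: Y_def)
  then have closed_Y: "closed Y"
    by (simp only:) (intro closed_agree closed_Int subshift_closed[OF sub] closed_INT ballI closed_translate_vimage)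
  have "x \<in> Y" using x(1) p(2) by (simp add: Y_def)
  then have Y: "Y \<subseteq> X" "Y \<noteq> {}" by (auto simp: Y_def)
  have inv: "translate p y \<in> Y" "translate (- p) y \<in> Y" if y: "y \<in> Y" for y
  proof -
    have "translate (k * p) (translate p y) = translate ((k + 1) * p) y"
      "translate (k * p) (translate (- p) y) = translate ((k - 1) * p) y" for k
      by (simp_all add: algebra_simps)
    moreover have "y \<in> X" "\<And>k. agree n (translate (k * p) y) x" using y by (auto simp: Y_def)
    ultimately show "translate p y \<in> Y" "translate (- p) y \<in> Y"
      using subshift_translate_mem[OF sub] unfolding Y_def by simp_all
  qed
  have "\<exists>Z\<subseteq>Y. Z \<noteq> {} \<and> closed Z \<and> closed (X - Z) \<and> (\<forall>z\<in>Z. translate p z \<in> Z \<and> translate (- p) z \<in> Z)"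
    by (rule periodic_closed_contains_clopen[OF X closed_Y Y p(1)]) (erule inv(1), erule inv(2))
  then obtain Z where Z: "Z \<subseteq> Y" "Z \<noteq> {}" "closed Z" "closed (X - Z)"
    "\<forall>z\<in>Z. translate p z \<in> Z \<and> translate (- p) z \<in> Z"
    by blast
  have "Z \<subseteq> X" using Z(1) by (auto simp: Y_def)
  have "compact Z"
    using compact_Int_closed[OF subshift_compact[OF sub] Z(3)] \<open>Z \<subseteq> X\<close> by (simp add: Int_absorb1)
  then obtain m where m: "\<forall>z\<in>Z. \<forall>y\<in>X - Z. \<not> agree m z y"
    using separated_by_window[of Z "X - Z"] Z(4) by blast
  define V where "V = {y. \<exists>z\<in>Z. agree m z y}"
  have XV: "X \<inter> V = Z" using m \<open>Z \<subseteq> X\<close> by (auto simp: V_def intro: agree_refl)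
  have "agree n (translate p z) z" if "z \<in> Z" for z
  proof -
    have "z \<in> Y" using that Z(1) by blast
    then have k: "agree n (translate (k * p) z) x" for k by (simp add: Y_def)
    have "agree n (translate p z) x" "agree n z x" using k[of 1] k[of 0] by simp_all
    then show ?thesis using agree_trans[OF _ agree_sym] by blast
  qed
  then have "\<forall>x\<in>X \<inter> V. translate p x \<in> V \<and> translate (- p) x \<in> V \<and> agree n (translate p x) x"
    using Z(5) XV by blast
  moreover have "\<forall>x y. agree m x y \<longrightarrow> x \<in> V \<longrightarrow> y \<in> V" unfolding V_def using agree_trans by blast
  moreover have "X \<inter> V \<noteq> {}" using Z(2) XV by simp
  ultimately show ?thesis
    unfolding locally_periodic_def using p(1)
    by (intro exI[of _ p] exI[of _ m] exI[of _ V] conjI)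
qed

section \<open>Orbit closures of Toeplitz sequences\<close>

text \<open>
  The central words of \<open>x\<close> recur with a period, so every translate of \<open>x\<close> shows them within bounded
  distance of the origin, and then so does every point of the closure. Hence \<open>x\<close> lies in the orbit
  closure of each point, which is minimality.
\<close>

lemma toeplitz_orbit_closure:
  assumes A: "finite A" "x \<in> full_shift A" and x: "toeplitz_sequence x"
    and X: "X = top_of_set (full_shift A) closure_of shift_orbit x"
  shows "minimal_subshift X" "x \<in> X" "X = {y. \<forall>n. \<exists>k. agree n (translate k x) y}"
proof -
  have orb: "shift_orbit x \<subseteq> full_shift A"
    using A(2) by (auto simp: shift_orbit_def full_shift_def)
  then have "full_shift A \<inter> shift_orbit x = shift_orbit x" by blast
  moreover have "closure (shift_orbit x) \<subseteq> full_shift A"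
    by (rule closure_minimal[OF orb closed_full_shift])
  ultimately have "X = closure (shift_orbit x)"
    unfolding X by (auto simp: closure_of_subtopology)
  then show X_eq: "X = {y. \<forall>n. \<exists>k. agree n (translate k x) y}"
    by (auto simp: mem_closure_iff_agree shift_orbit_eq_translates)
  show xX: "x \<in> X" unfolding X_eq by (auto intro!: exI[of _ 0])
  have inv: "translate j y \<in> X" if "y \<in> X" for j y
    unfolding X_eq
  proof (intro CollectI allI)
    fix n
    obtain k where "agree (n + nat \<bar>j\<bar>) (translate k x) y" using \<open>y \<in> X\<close> unfolding X_eq by blast
    then have "agree n (translate j (translate k x)) (translate j y)" by (rule agree_translate) simp
    then show "\<exists>k. agree n (translate k x) (translate j y)" by auto
  qed
  have "shift ` X = X"
  proof (intro equalityI subsetI)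
    fix y assume "y \<in> X"
    then have "translate (- 1) y \<in> X" "y = shift (translate (- 1) y)" using inv by (simp_all add: shift_eq_translate)
    then show "y \<in> shift ` X" by blast
  qed (use inv in \<open>auto simp: shift_eq_translate\<close>)
  moreover have "closedin (top_of_set (full_shift A)) X" unfolding X by (rule closedin_closure_of)
  ultimately have sub: "subshift X" using A(1) unfolding subshift_def by blast
  have returns: "\<exists>k. agree n (translate k y) x" if y: "y \<in> X" for y n
  proof -
    obtain p where p: "p \<ge> 1" "\<And>k. agree n (translate (k * p) x) x"
      using toeplitz_window_period[OF x] by blast
    obtain k where k: "agree (n + nat p) (translate k x) y" using y unfolding X_eq by blast
    \<comment> \<open>The shift from the position \<open>k\<close> to the next multiple of \<open>p\<close>, which is less than \<open>p\<close> and so stays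
  within the window where \<open>y\<close> is known.\<close>
  define r where "r = - k mod p"
    have r: "0 \<le> r" "r < p" using p(1) by (auto simp: r_def)
    have "(r + k) mod p = 0" by (simp add: r_def mod_simps)
    then obtain l where l: "r + k = l * p" by (metis mod_0_imp_dvd dvd_def mult.commute)
    have "agree n (translate r (translate k x)) (translate r y)"
      using r(1,2) by (intro agree_translate[OF k]) auto
    moreover have "agree n (translate (r + k) x) x" using p(2) l by simp
    ultimately have "agree n (translate r y) x" using agree_trans[OF agree_sym] by simp
    then show ?thesis by blast
  qed
  have "\<exists>k. agree n (translate k y) z" if y: "y \<in> X" and z: "z \<in> X" for y z n
  proof -
    obtain k where k: "agree n (translate k x) z" using z unfolding X_eq by blast
    obtain j where j: "agree (n + nat \<bar>k\<bar>) (translate j y) x" using returns[OF y] by blast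
    have "agree n (translate k (translate j y)) (translate k x)" by (rule agree_translate[OF j]) simp
    then have "agree n (translate (k + j) y) z" using agree_trans[OF _ k] by simp
    then show ?thesis by blast
  qed
  then show "minimal_subshift X" using sub by (simp add: minimal_subshift_iff)
qed

lemma minimal_with_toeplitz_sequence:
  assumes X: "minimal_subshift X" and x: "x \<in> X" "toeplitz_sequence x"
  shows "toeplitz_subshift X"
proof -
  note sub = minimal_imp_subshift[OF X]
  obtain A where A: "finite A" "X \<subseteq> full_shift A"
    using sub by (auto simp: subshift_def dest: closedin_imp_subset)
  define Y where "Y = top_of_set (full_shift A) closure_of shift_orbit x"
  have Y: "Y = {y. \<forall>n. \<exists>k. agree n (translate k x) y}"
    using toeplitz_orbit_closure(3)[OF A(1) _ x(2) Y_def] A(2) x(1) by blast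
  have "X = Y"
  proof
    show "X \<subseteq> Y" using minimal_dense[OF X x(1)] by (auto simp: Y)
    show "Y \<subseteq> X"
    proof
      fix y assume "y \<in> Y"
      then show "y \<in> X"
        using subshift_translate_mem[OF sub x(1)] unfolding Y
        by (intro closed_agree_mem[OF subshift_closed[OF sub]]) blast
    qed
  qed
  then show ?thesis using A x Y_def unfolding toeplitz_subshift_def by blast
qed

lemma toeplitz_minimal:
  assumes "toeplitz_subshift X" shows "minimal_subshift X"
  using assms toeplitz_orbit_closure(1) unfolding toeplitz_subshift_def by blast

lemma words_orbit_closure:
  assumes X: "X = {z. \<forall>n. \<exists>k. agree n (translate k y) z}" and y: "y \<in> X"
  shows "words n X = words n {y}"
proof
  show "words n {y} \<subseteq> words n X" using y by (auto simp: words_eq_windows)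
  show "words n X \<subseteq> words n {y}"
  proof
    fix w assume "w \<in> words n X"
    then obtain z i where z: "z \<in> X" "w = window n z i" by (auto simp: words_eq_windows)
    obtain k where k: "agree (nat \<bar>i\<bar> + n) (translate k y) z" using z(1) unfolding X by blast
    have "window n z i = window n y (k + i)"
    proof (rule window_cong)
      fix j assume "0 \<le> j" "j < int n"
      then show "z (i + j) = y (k + i + j)"
        using agreeD[OF k, of "i + j"] by (simp add: algebra_simps)
    qed
    then show "w \<in> words n {y}" using z(2) by (auto simp: words_eq_windows)
  qed
qed

section \<open>Maps that reverse the shift\<close>

text \<open>
  The argument of Curtis, Hedlund and Lyndon. By compactness the letter of the image at \<open>0\<close> depends on
  a finite window of the argument; because the map reverses the shift, the letter at \<open>-i\<close> depends in
  the same way on the window around \<open>i\<close>.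
\<close>

lemma reversing_map_local:
  assumes X: "subshift X" and cont: "continuous_on X \<phi>" and maps: "\<phi> ` X \<subseteq> X"
    and conj: "\<And>x. x \<in> X \<Longrightarrow> \<phi> (shift x) = inv shift (\<phi> x)"
  shows "\<exists>n. \<forall>x\<in>X. \<forall>i j. agree n (translate i x) (translate j x) \<longrightarrow> \<phi> x (- i) = \<phi> x (- j)"
proof -
  have equiv: "\<phi> (translate k x) = translate (- k) (\<phi> x)" if x: "x \<in> X" for k x
  proof (induction k rule: int_induct[of _ 0])
    case (step1 k)
    have "\<phi> (translate (k + 1) x) = \<phi> (shift (translate k x))"
      by (simp add: shift_eq_translate add.commute)
    also have "\<dots> = translate (- 1) (\<phi> (translate k x))"
      using conj subshift_translate_mem[OF X x] by (simp add: inv_shift_eq_translate)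
    also have "\<dots> = translate (- 1) (translate (- k) (\<phi> x))" by (simp only: step1)
    also have "\<dots> = translate (- (k + 1)) (\<phi> x)" by (simp add: algebra_simps)
    finally show ?case .
  next
    case (step2 k)
    have "\<phi> (translate k x) = \<phi> (shift (translate (k - 1) x))"
      by (simp add: shift_eq_translate)
    also have "\<dots> = translate (- 1) (\<phi> (translate (k - 1) x))"
      using conj subshift_translate_mem[OF X x] by (simp add: inv_shift_eq_translate)
    finally have "translate 1 (\<phi> (translate k x)) = \<phi> (translate (k - 1) x)" by simp
    then have "\<phi> (translate (k - 1) x) = translate 1 (translate (- k) (\<phi> x))" by (simp only: step2)
    also have "\<dots> = translate (- (k - 1)) (\<phi> x)" by (simp add: algebra_simps)
    finally show ?case .
  qed simp
  have closed_P: "closed {x\<in>X. \<phi> x 0 \<in> A}" for A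
  proof -
    have "continuous_on X (\<lambda>x. \<phi> x 0)" by (rule continuous_on_product_then_coordinatewise[OF cont])
    moreover have "closed A" by (auto simp: closed_def open_discrete)
    ultimately have "closed (X \<inter> (\<lambda>x. \<phi> x 0) -` A)"
      using continuous_closed_preimage subshift_closed[OF X] by blast
    then show ?thesis by (simp add: vimage_def Int_def)
  qed
  have "\<exists>n. \<forall>x\<in>{x\<in>X. \<phi> x 0 \<in> {a}}. \<forall>y\<in>{x\<in>X. \<phi> x 0 \<in> - {a}}. \<not> agree n x y" for a
  proof (rule separated_by_window[OF _ closed_P])
    have "compact (X \<inter> {x\<in>X. \<phi> x 0 \<in> {a}})"
      by (rule compact_Int_closed[OF subshift_compact[OF X] closed_P])
    moreover have "X \<inter> {x\<in>X. \<phi> x 0 \<in> {a}} = {x\<in>X. \<phi> x 0 \<in> {a}}" by blast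
    ultimately show "compact {x\<in>X. \<phi> x 0 \<in> {a}}" by simp
  qed auto
  then obtain n where n: "\<And>a x y. x \<in> X \<Longrightarrow> y \<in> X \<Longrightarrow> \<phi> x 0 = a \<Longrightarrow> \<phi> y 0 \<noteq> a \<Longrightarrow> \<not> agree (n a) x y"
    by (simp; metis)
  obtain A where A: "finite A" "X \<subseteq> full_shift A"
    using X by (auto simp: subshift_def dest: closedin_imp_subset)
  have fin: "\<phi> x 0 \<in> A" if "x \<in> X" for x using maps A(2) that by (force simp: full_shift_def)
  define N where "N = (\<Sum>a\<in>A. n a)"
  have N: "n a \<le> N" if "a \<in> A" for a unfolding N_def using A(1) that by (intro member_le_sum) auto
  have "\<phi> x 0 = \<phi> y 0" if "x \<in> X" "y \<in> X" "agree N x y" for x y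
    using n[OF that(1,2) refl] agree_mono[OF that(3) N[OF fin[OF that(1)]]] by metis
  then have "\<phi> x (- i) = \<phi> x (- j)" if "x \<in> X" "agree N (translate i x) (translate j x)" for x i j
    using that subshift_translate_mem[OF X that(1)] equiv[OF that(1)] by (metis translate_apply add_0)
  then show ?thesis by blast
qed

lemma reflection_rigid_not_conjugate:
  assumes X: "subshift X" and rigid: "\<And>n. reflection_rigid n X"
  shows "\<not> conjugate_systems X shift X (inv shift)"
proof
  assume "conjugate_systems X shift X (inv shift)"
  then obtain \<phi> \<psi> where h: "homeomorphism X X \<phi> \<psi>" and c: "\<And>x. x \<in> X \<Longrightarrow> \<phi> (shift x) = inv shift (\<phi> x)"
    unfolding conjugate_systems_def by blast
  have im: "\<phi> ` X = X" and cont: "continuous_on X \<phi>"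
    using h by (auto simp: homeomorphism_def)
  obtain n where n: "\<And>x i j. x \<in> X \<Longrightarrow> agree n (translate i x) (translate j x) \<Longrightarrow> \<phi> x (- i) = \<phi> x (- j)"
    using reversing_map_local[OF X cont _ c] im by blast
  obtain x where x: "x \<in> X" "\<And>y. y \<in> X \<Longrightarrow> \<exists>i j. agree n (translate i x) (translate j x) \<and> y (- i) \<noteq> y (- j)"
    using rigid[of n] unfolding reflection_rigid_def by blast
  show False using x(2)[of "\<phi> x"] n[OF x(1)] im x(1) by blast
qed

text \<open>
  Unless it is empty, such a subshift is a single periodic orbit, and reflecting the orbit about one of its points is a
  conjugacy. Continuity is automatic because all subsets are closed.
\<close>

lemma finite_minimal_conjugate_inverse:
  assumes X: "minimal_subshift X" and fin: "finite X"
  shows "conjugate_systems X shift X (inv shift)"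
proof (cases "X = {}")
  case True
  then show ?thesis by (auto simp: conjugate_systems_def homeomorphism_def)
next
  case False
  then obtain x where x: "x \<in> X" by blast
  note sub = minimal_imp_subshift[OF X]
  have X_eq: "X = range (\<lambda>k. translate k x)"
  proof
    show range: "range (\<lambda>k. translate k x) \<subseteq> X" using subshift_translate_mem[OF sub x] by blast
    then have "finite (range (\<lambda>k. translate k x))" by (rule finite_subset[OF _ fin])
    then have cl: "closed (range (\<lambda>k. translate k x))" by (rule closed_finite)
    show "X \<subseteq> range (\<lambda>k. translate k x)"
      using minimal_dense[OF X x] by (intro subsetI closed_agree_mem[OF cl]) blast
  qed
  have refl: "translate (- j) x = translate (- k) x" if "translate j x = translate k x" for j k
    using arg_cong[OF that, of "translate (- j - k)"] by simp
  define \<phi> where "\<phi> y = translate (- (SOME k. y = translate k x)) x" for y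
  have \<phi>: "\<phi> (translate k x) = translate (- k) x" for k
    unfolding \<phi>_def by (rule refl, rule sym, rule someI[of _ k]) simp
  have "continuous_on X \<phi>"
    using closed_finite[OF fin] closed_finite[OF finite_subset[OF _ fin]]
    by (subst continuous_on_closed_vimage) auto
  moreover have "\<phi> y \<in> X" "\<phi> (\<phi> y) = y" if "y \<in> X" for y
    using that \<phi> by (auto simp: X_eq)
  ultimately have "homeomorphism X X \<phi> \<phi>"
    unfolding homeomorphism_def by (auto simp: image_iff) metis+
  moreover have "\<phi> (shift y) = inv shift (\<phi> y)" if "y \<in> X" for y
  proof -
    obtain k where y: "y = translate k x" using \<open>y \<in> X\<close> by (auto simp: X_eq)
    have "shift y = translate (1 + k) x" by (simp add: y shift_eq_translate)
    then have "\<phi> (shift y) = translate (- (1 + k)) x" by (simp only: \<phi>)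
    moreover have "inv shift (\<phi> y) = translate (- 1 - k) x" by (simp add: y \<phi> inv_shift_eq_translate)
    ultimately show ?thesis by simp
  qed
  ultimately show ?thesis unfolding conjugate_systems_def by blast
qed

section \<open>A Toeplitz sequence without reversal\<close>

text \<open>
  The bi-infinite fixed point of the substitution \<open>a \<mapsto> 01a011101\<close>, with \<open>True\<close> for \<open>1\<close>. The variable
  letter stands neither at the first nor at the last place of the block, so desubstitution decreases
  \<open>\<bar>i\<bar>\<close> and reaches a constant letter from every position.
\<close>

function rigid_seq :: "int \<Rightarrow> bool" where
  "rigid_seq i = (if i mod 9 = 2 then rigid_seq (i div 9) else i mod 9 \<in> {1, 4, 5, 6, 8})"
  by auto
termination
proof (relation "Wellfounded.measure (\<lambda>i. nat \<bar>i\<bar>)")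
  fix i :: int assume "i mod 9 = 2"
  then have "i = 9 * (i div 9) + 2" using div_mult_mod_eq[of i 9] by simp
  then have "\<bar>i div 9\<bar> < \<bar>i\<bar>" by arith
  then show "(i div 9, i) \<in> Wellfounded.measure (\<lambda>i. nat \<bar>i\<bar>)" by simp
qed simp

declare rigid_seq.simps [simp del]

lemma rigid_seq_toeplitz: "toeplitz_sequence rigid_seq"
  unfolding toeplitz_sequence_def
proof
  fix i show "\<exists>p\<ge>1. \<forall>k. rigid_seq i = rigid_seq (i + k * p)"
  proof (induction i rule: rigid_seq.induct)
    case (1 i)
    show ?case
    proof (cases "i mod 9 = 2")
      case True
      then obtain p where p: "p \<ge> 1" "\<And>k. rigid_seq (i div 9) = rigid_seq (i div 9 + k * p)"
        using 1 by blast
      have "i + k * (9 * p) = i + (k * p) * 9" for k by simp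
      then have "(i + k * (9 * p)) mod 9 = 2" "(i + k * (9 * p)) div 9 = i div 9 + k * p" for k
        using True by (simp_all only: mod_mult_self1 div_mult_self1)
      then have "rigid_seq i = rigid_seq (i + k * (9 * p))" for k
        using p(2)[of k] True by (simp add: rigid_seq.simps[of i] rigid_seq.simps[of "i + k * (9 * p)"])
      then show ?thesis using p(1) by (intro exI[of _ "9 * p"]) simp
    next
      case False
      then have "rigid_seq i = rigid_seq (i + k * 9)" for k
        by (simp add: rigid_seq.simps[of i] rigid_seq.simps[of "i + k * 9"])
      then show ?thesis by (intro exI[of _ 9]) simp
    qed
  qed
qed

lemma rigid_seq_letter:
  "i mod 9 \<noteq> 2 \<Longrightarrow> rigid_seq i \<longleftrightarrow> i mod 9 \<in> {1, 4, 5, 6, 8}"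
  by (subst rigid_seq.simps) simp

text \<open>
  The word \<open>01\<close> starts at \<open>0\<close>, \<open>3\<close>, \<open>7\<close> and the word \<open>11\<close> at \<open>4\<close>, \<open>5\<close>. If reading the sequence in
  windows of two letters produced the sequence from \<open>c\<close> backwards, the letters at \<open>c\<close>, \<open>c - 3\<close>,
  \<open>c - 7\<close> would coincide, and likewise those at \<open>c - 4\<close>, \<open>c - 5\<close>. In each residue class of \<open>c\<close> this
  fails already on the constant letters of the substitution.
\<close>

lemma rigid_seq_chiral:
  "\<not> (rigid_seq c = rigid_seq (c - 3) \<and> rigid_seq c = rigid_seq (c - 7) \<and>
      rigid_seq (c - 4) = rigid_seq (c - 5))"
proof -
  define r where "r = c mod 9"
  have "0 \<le> r" "r < 9" by (simp_all add: r_def)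
  then have r: "r = 0 \<or> r = 1 \<or> r = 2 \<or> r = 3 \<or> r = 4 \<or> r = 5 \<or> r = 6 \<or> r = 7 \<or> r = 8"
    by presburger
  have letter: "rigid_seq (c - k) \<longleftrightarrow> (r - k) mod 9 \<in> {1, 4, 5, 6, 8}" if "(r - k) mod 9 \<noteq> 2" for k
    using rigid_seq_letter[of "c - k"] that by (simp add: r_def mod_diff_left_eq)
  show ?thesis
    using r letter[of 0] letter[of 3] letter[of 4] letter[of 5] letter[of 7] by (elim disjE) simp_all
qed

text \<open>
  The sequence \<open>y\<close> arises from \<open>rigid_seq\<close> by replacing the letters by two blocks of length \<open>h\<close>, of
  which only the values on \<open>[0, h)\<close> matter. The blocks differ at some offset \<open>d\<close>, so that the letter
  can be recovered from the block.
\<close>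

definition block_expansion :: "int \<Rightarrow> (bool \<Rightarrow> int \<Rightarrow> int) \<Rightarrow> (int \<Rightarrow> int) \<Rightarrow> bool" where
  "block_expansion h W y \<longleftrightarrow> h \<ge> 1 \<and> (\<exists>d. 0 \<le> d \<and> d < h \<and> W True d \<noteq> W False d) \<and>
     (\<forall>i. y i = W (rigid_seq (i div h)) (i mod h))"

lemma block_expansion_at:
  assumes "block_expansion h W y" "0 \<le> d" "d < h"
  shows "y (j * h + d) = W (rigid_seq j) d"
  using assms by (simp add: block_expansion_def)

text \<open>
  Nine consecutive letters form the image of one letter under the substitution, and so the blocks may
  be combined into groups of nine.
\<close>

lemma block_expansion_coarsen:
  assumes "block_expansion h W y"
  shows "\<exists>W'. block_expansion (9 * h) W' y"
proof -
  obtain d where h: "h \<ge> 1" and d: "0 \<le> d" "d < h" "W True d \<noteq> W False d"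
    and y: "\<And>i. y i = W (rigid_seq (i div h)) (i mod h)"
    using assms by (auto simp: block_expansion_def)
  define W' where
    "W' a s = W (if s div h = 2 then a else s div h \<in> {1, 4, 5, 6, 8}) (s mod h)" for a s
  have "y i = W' (rigid_seq (i div (9 * h))) (i mod (9 * h))" for i
  proof -
    have m: "i mod (h * 9) = h * (i div h mod 9) + i mod h" using h by (simp add: zmod_zmult2_eq)
    then have "i mod (h * 9) div h = i div h mod 9" "i mod (h * 9) mod h = i mod h" using h by simp_all
    moreover have "i div (h * 9) = i div h div 9" using h by (simp add: zdiv_zmult2_eq)
    ultimately show ?thesis
      unfolding y[of i] W'_def by (simp add: mult.commute[of 9] rigid_seq.simps[of "i div h"])
  qed
  \<comment> \<open>Only the block at the place of the variable letter depends on \<open>a\<close>.\<close>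
  moreover have "W' True (2 * h + d) \<noteq> W' False (2 * h + d)"
    using h d by (simp add: W'_def)
  ultimately show ?thesis
    using h d by (intro exI[of _ W']) (auto simp: block_expansion_def intro!: exI[of _ "2 * h + d"])
qed

lemma block_expansion_arbitrarily_long:
  assumes "block_expansion h W y"
  shows "\<exists>h' W'. h' > int n \<and> block_expansion h' W' y"
proof (induction n)
  case 0
  then show ?case using assms by (intro exI[of _ h] exI[of _ W]) (auto simp: block_expansion_def)
next
  case (Suc n)
  then obtain h' W' where "h' > int n" "block_expansion h' W' y" by blast
  moreover from this obtain W'' where "block_expansion (9 * h') W'' y" using block_expansion_coarsen by blast
  ultimately show ?case by (intro exI[of _ "9 * h'"] exI[of _ W'']) auto
qed

text \<open>
  The offset \<open>s\<close> is chosen such that the reflections \<open>t - i\<close> of the positions \<open>i = a h + s\<close> all fall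
  on the offset \<open>d\<close> that tells the two blocks apart. Because \<open>h > 2n\<close>, the window of radius \<open>n\<close> around
  \<open>i\<close> meets the block containing \<open>i\<close> and at most one of its neighbours, always on the same side.
  Hence two positions whose blocks carry the same two letters have the same window, and their
  reflections would have to carry equal letters, against \<open>rigid_seq_chiral\<close>.
\<close>

lemma block_expansion_chiral:
  assumes exp: "block_expansion h W y" and hn: "h > 2 * int n"
  shows "\<exists>i j. \<bar>i\<bar> \<le> 9 * h \<and> \<bar>j\<bar> \<le> 9 * h \<and>
           agree n (translate i y) (translate j y) \<and> y (t - i) \<noteq> y (t - j)"
proof -
  obtain d where h: "h \<ge> 1" and d: "0 \<le> d" "d < h" "W True d \<noteq> W False d"
    using exp by (auto simp: block_expansion_def)
  define s where "s = (t - d) mod h"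
  \<comment> \<open>If the windows reach to the left neighbour (or to none), the two blocks in question are those before
  and at \<open>i\<close>; counting blocks from the left one gives the summand \<open>1\<close>.\<close>
  define e :: int where "e = (if s + int n < h then 1 else 0)"
  define c where "c = (t - d) div h - e"
  have s: "0 \<le> s" "s < h" using h by (simp_all add: s_def)
  have "(t - d) div h * h + s = t - d" unfolding s_def by (rule div_mult_mod_eq)
  moreover have "c + e = (t - d) div h" by (simp add: c_def)
  ultimately have t: "t = (c + e) * h + s + d" by simp
  define pos where "pos a = (a + e) * h + s" for a
  have w: "0 \<le> e * h + s + r" "e * h + s + r < 2 * h" if "\<bar>r\<bar> \<le> int n" for r
    using that s hn by (auto simp: e_def)
  have agr: "agree n (translate (pos a) y) (translate (pos b) y)"
    if ab: "rigid_seq a = rigid_seq b" "rigid_seq (a + 1) = rigid_seq (b + 1)" for a b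
    unfolding agree_def
  proof (intro allI impI)
    fix r assume r: "\<bar>r\<bar> \<le> int n"
    define u where "u = e * h + s + r"
    have u: "0 \<le> u" "u < 2 * h" using w[OF r] by (simp_all add: u_def)
    have at: "y (a * h + u) = (if u < h then W (rigid_seq a) u else W (rigid_seq (a + 1)) (u - h))" for a
      using block_expansion_at[OF exp, of u a] block_expansion_at[OF exp, of "u - h" "a + 1"] u
      by (auto simp: algebra_simps)
    have "r + pos a = a * h + u" "r + pos b = b * h + u" by (simp_all add: pos_def u_def algebra_simps)
    then show "translate (pos a) y r = translate (pos b) y r" using at ab by simp
  qed
  have val: "y (t - pos a) = W (rigid_seq (c - a)) d" for a
  proof -
    have "t - pos a = (c - a) * h + d" unfolding t pos_def by (simp add: algebra_simps)
    then show ?thesis using block_expansion_at[OF exp d(1,2)] by simp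
  qed
  have bd: "\<bar>pos a\<bar> \<le> 9 * h" if "0 \<le> a" "a \<le> 7" for a
  proof -
    have "0 \<le> a + e" "a + e \<le> 8" using that by (auto simp: e_def)
    then have "0 \<le> (a + e) * h" "(a + e) * h \<le> 8 * h" using h by (auto intro: mult_right_mono)
    then show ?thesis using s unfolding pos_def by linarith
  qed
  have letters: "rigid_seq 0 = False" "rigid_seq 1 = True" "rigid_seq 3 = False" "rigid_seq 4 = True"
    "rigid_seq 5 = True" "rigid_seq 6 = True" "rigid_seq 7 = False" "rigid_seq 8 = True"
    by (simp_all add: rigid_seq.simps)
  have found: ?thesis if "rigid_seq (c - a) \<noteq> rigid_seq (c - b)" "rigid_seq a = rigid_seq b"
    "rigid_seq (a + 1) = rigid_seq (b + 1)" "0 \<le> a" "a \<le> 7" "0 \<le> b" "b \<le> 7" for a b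
  proof -
    have "y (t - pos a) \<noteq> y (t - pos b)"
      using that(1) d(3) unfolding val by (cases "rigid_seq (c - a)"; cases "rigid_seq (c - b)") auto
    then show ?thesis
      using agr[OF that(2,3)] bd[OF that(4,5)] bd[OF that(6,7)] by blast
  qed
  consider "rigid_seq c \<noteq> rigid_seq (c - 3)" | "rigid_seq c \<noteq> rigid_seq (c - 7)"
    | "rigid_seq (c - 4) \<noteq> rigid_seq (c - 5)"
    using rigid_seq_chiral[of c] by blast
  then show ?thesis
  proof cases
    case 1
    show ?thesis by (rule found[of 0 3]) (use 1 letters in simp_all)
  next
    case 2
    show ?thesis by (rule found[of 0 7]) (use 2 letters in simp_all)
  next
    case 3
    show ?thesis by (rule found[of 4 5]) (use 3 letters in simp_all)
  qed
qed

lemma toeplitz_expansion: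
  assumes exp: "block_expansion h W y"
  shows "toeplitz_sequence y"
  unfolding toeplitz_sequence_def
proof
  fix i
  have h: "h \<ge> 1" and y: "\<And>i. y i = W (rigid_seq (i div h)) (i mod h)"
    using exp by (auto simp: block_expansion_def)
  obtain p where p: "p \<ge> 1" "\<And>k. rigid_seq (i div h) = rigid_seq (i div h + k * p)"
    using rigid_seq_toeplitz unfolding toeplitz_sequence_def by blast
  have "y i = y (i + k * (p * h))" for k
  proof -
    have "i + k * (p * h) = i + (k * p) * h" by simp
    then have "(i + k * (p * h)) div h = i div h + k * p" "(i + k * (p * h)) mod h = i mod h"
      using h by (simp_all only: mod_mult_self1 div_mult_self1)
    then show ?thesis unfolding y using p(2)[of k] by simp
  qed
  moreover have "p * h \<ge> 1" using p(1) h by (metis mult_mono' mult_1 zero_le_one)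
  ultimately show "\<exists>p\<ge>1. \<forall>k. y i = y (i + k * p)" by blast
qed

lemma block_expansion_rigid:
  assumes X: "X = {z. \<forall>n. \<exists>k. agree n (translate k y) z}" and y: "y \<in> X"
    and exp: "block_expansion h W y"
  shows "reflection_rigid n X"
proof -
  obtain h' W' where h': "h' > int (2 * n)" "block_expansion h' W' y"
    using block_expansion_arbitrarily_long[OF exp] by blast
  define m where "m = nat (9 * h')"
  have m: "9 * h' = int m" using h'(1) by (simp add: m_def)
  have "\<exists>i j. \<bar>i\<bar> \<le> int m \<and> \<bar>j\<bar> \<le> int m \<and> agree n (translate i y) (translate j y) \<and> z (- i) \<noteq> z (- j)"
    if z: "z \<in> X" for z
  proof -
    obtain t where t: "agree m (translate t y) z" using z unfolding X by blast
    obtain i j where ij: "\<bar>i\<bar> \<le> int m" "\<bar>j\<bar> \<le> int m" "agree n (translate i y) (translate j y)"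
      "y (t - i) \<noteq> y (t - j)"
      using block_expansion_chiral[OF h'(2), of n t] h'(1) unfolding m by auto
    have "z (- i) = y (t - i)" "z (- j) = y (t - j)"
      using agreeD[OF t, of "- i"] agreeD[OF t, of "- j"] ij(1,2) by (simp_all add: algebra_simps)
    then show ?thesis using ij by (intro exI[of _ i] exI[of _ j]) simp
  qed
  then show ?thesis using y unfolding reflection_rigid_def by blast
qed

section \<open>Blocks that reproduce the words of a given subshift\<close>

text \<open>
  By recurrence every word of \<open>X\<close> occurs far to the right in \<open>x\<close>. A period there would thus be a
  period of all points of \<open>X\<close>, of which there could be only finitely many.
\<close>

lemma infinite_minimal_not_eventually_periodic:
  assumes X: "minimal_subshift X" "infinite X" and x: "x \<in> X" and q: "q \<ge> 1"
  shows "\<exists>i\<ge>a. x (i + q) \<noteq> x i"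
proof (rule ccontr)
  assume neg: "\<not> ?thesis"
  then have per: "x (i + q) = x i" if "i \<ge> a" for i using that by blast
  note sub = minimal_imp_subshift[OF X(1)]
  obtain A where A: "finite A" "X \<subseteq> full_shift A"
    using sub by (auto simp: subshift_def dest: closedin_imp_subset)
  have per_all: "y (i + q) = y i" if y: "y \<in> X" for y i
  proof -
    define n where "n = nat (\<bar>i\<bar> + q)"
    obtain R where R: "\<And>z. z \<in> X \<Longrightarrow> \<exists>k. 0 \<le> k \<and> k \<le> R \<and> agree n (translate k z) y"
      using minimal_recurrence[OF X(1) y] by metis
    obtain k where k: "0 \<le> k" "agree n (translate k (translate (a + \<bar>i\<bar>) x)) y"
      using R subshift_translate_mem[OF sub x] by blast
    define j where "j = k + (a + \<bar>i\<bar>)"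
    have "translate j x (i + q) = y (i + q)" "translate j x i = y i"
      using agreeD[OF k(2), of "i + q"] agreeD[OF k(2), of i] q
      by (simp_all add: n_def j_def algebra_simps)
    moreover have "x (i + j + q) = x (i + j)" using k(1) by (intro per) (simp add: j_def)
    ultimately show ?thesis by (simp add: algebra_simps)
  qed
  have per_mod: "y i = y (i mod q)" if y: "y \<in> X" for y i
  proof -
    have "y (i + k * q) = y i" for i k
    proof (induction k rule: int_induct[of _ 0])
      case (step1 k)
      then show ?case using per_all[OF y, of "i + k * q"] by (simp add: algebra_simps)
    next
      case (step2 k)
      then show ?case using per_all[OF y, of "i + (k - 1) * q"] by (simp add: algebra_simps)
    qed simp
    from this[of "i mod q" "i div q"] show ?thesis by simp
  qed
  have "inj_on (\<lambda>y. restrict y {0..<q}) X"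
  proof (rule inj_onI)
    fix y z assume yz: "y \<in> X" "z \<in> X" "restrict y {0..<q} = restrict z {0..<q}"
    have "y i = z i" for i
      using per_mod[OF yz(1), of i] per_mod[OF yz(2), of i] fun_cong[OF yz(3), of "i mod q"] q by simp
    then show "y = z" by blast
  qed
  moreover have "(\<lambda>y. restrict y {0..<q}) ` X \<subseteq> PiE {0..<q} (\<lambda>_. A)"
    using A(2) by (auto simp: full_shift_def)
  then have "finite ((\<lambda>y. restrict y {0..<q}) ` X)"
    by (rule finite_subset) (simp add: A(1) finite_PiE)
  ultimately show False using X(2) finite_imageD by blast
qed

lemma minimal_late_return:
  assumes X: "minimal_subshift X" and x: "x \<in> X" "y \<in> X"
  shows "\<exists>b\<ge>a. agree n (translate b x) y"
proof -
  obtain R where "\<And>z. z \<in> X \<Longrightarrow> \<exists>k. 0 \<le> k \<and> k \<le> R \<and> agree n (translate k z) y"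
    using minimal_recurrence[OF X x(2)] by metis
  then obtain k where "0 \<le> k" "agree n (translate k (translate a x)) y"
    using subshift_translate_mem[OF minimal_imp_subshift[OF X] x(1)] by blast
  then show ?thesis by (intro exI[of _ "k + a"]) simp
qed

lemma finite_words:
  assumes "subshift X" shows "finite (words n X)"
proof -
  obtain A where A: "finite A" "X \<subseteq> full_shift A"
    using assms by (auto simp: subshift_def dest: closedin_imp_subset)
  have "words n X \<subseteq> {w. set w \<subseteq> A \<and> length w = n}"
    using A(2) by (fastforce simp: words_def full_shift_def)
  then show ?thesis using finite_lists_length_eq[OF A(1)] finite_subset by blast
qed

lemma words_before_bound:
  assumes X: "minimal_subshift X" and x: "x \<in> X"
  shows "\<exists>b. \<forall>w\<in>words n X. \<exists>i. 0 \<le> i \<and> i + int n \<le> b \<and> window n x i = w"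
proof -
  have "\<exists>i. 0 \<le> i \<and> window n x i = w" if "w \<in> words n X" for w
  proof -
    obtain y k where y: "y \<in> X" "w = window n y k" using \<open>w \<in> words n X\<close> by (auto simp: words_eq_windows)
    obtain b where b: "b \<ge> 0" "agree n (translate b x) (translate k y)"
      using minimal_late_return[OF X x, of "translate k y" 0 n]
        subshift_translate_mem[OF minimal_imp_subshift[OF X] y(1)] by blast
    have "window n x b = w"
      unfolding y(2)
    proof (rule window_cong)
      fix j assume "0 \<le> j" "j < int n"
      then show "x (b + j) = y (k + j)" using agreeD[OF b(2), of j] by (simp add: add.commute)
    qed
    then show ?thesis using b(1) by blast
  qed
  then obtain pos where pos: "\<And>w. w \<in> words n X \<Longrightarrow> 0 \<le> pos w \<and> window n x (pos w) = w" by metis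
  define b where "b = (\<Sum>w\<in>words n X. pos w) + int n"
  have "pos w \<le> (\<Sum>w\<in>words n X. pos w)" if "w \<in> words n X" for w
    using that pos finite_words[OF minimal_imp_subshift[OF X]] by (intro member_le_sum) auto
  then have "pos w + int n \<le> b" if "w \<in> words n X" for w
    using that by (simp add: b_def)
  then show ?thesis using pos by blast
qed

text \<open>
  Let \<open>v\<close> be the word of \<open>x\<close> on \<open>[0, n)\<close>, and let it occur at \<open>b\<close> and \<open>c\<close> too. The words \<open>r\<close> on
  \<open>[0, b)\<close> and \<open>s\<close> on \<open>[b, c)\<close> both start with \<open>v\<close> and are followed by \<open>v\<close> in \<open>x\<close>, so a concatenation
  of copies of \<open>r\<close> and \<open>s\<close> has only windows of length \<open>n\<close> that occur in \<open>x\<close>; if \<open>b\<close> is large, \<open>r\<close>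
  contains all the words of length \<open>n\<close> of \<open>X\<close>. The two blocks are \<open>rs\<close> and \<open>sr\<close>. If they were equal
  for arbitrarily large \<open>c\<close>, then \<open>x\<close> would have period \<open>b\<close> on \<open>[0, \<infinity>)\<close>.
\<close>

lemma blocks_with_words_of:
  assumes X: "minimal_subshift X" "infinite X"
  shows "\<exists>h W. h \<ge> 1 \<and> (\<exists>d. 0 \<le> d \<and> d < h \<and> W True d \<noteq> W False d) \<and>
     (\<forall>f y. (\<forall>i. y i = W (f (i div h)) (i mod h)) \<longrightarrow> (\<exists>k. f k) \<longrightarrow> words n {y} = words n X)"
proof -
  obtain x where x: "x \<in> X" using X(2) by (metis finite.emptyI ex_in_conv)
  note sub = minimal_imp_subshift[OF X(1)]
  obtain b0 where b0: "\<And>w. w \<in> words n X \<Longrightarrow> \<exists>i. 0 \<le> i \<and> i + int n \<le> b0 \<and> window n x i = w"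
    using words_before_bound[OF X(1) x] by metis
  obtain b where b: "b \<ge> max b0 (int n + 1)" "agree n (translate b x) x"
    using minimal_late_return[OF X(1) x x] by blast
  \<comment> \<open>The place where \<open>rs\<close> and \<open>sr\<close> will differ; \<open>c\<close> is taken so large that it lies inside \<open>s\<close>.\<close>
  obtain i0 where i0: "i0 \<ge> 0" "x (i0 + b) \<noteq> x i0"
    using infinite_minimal_not_eventually_periodic[OF X x, of b 0] b(1) by auto
  obtain c where c: "c \<ge> b + int n + i0 + 1" "agree n (translate c x) x"
    using minimal_late_return[OF X(1) x x] by blast
  have xb: "x (b + u) = x u" if "0 \<le> u" "u < int n" for u
    using agreeD[OF b(2), of u] that by (simp add: add.commute)
  have xc: "x (c + u) = x u" if "0 \<le> u" "u < int n" for u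
    using agreeD[OF c(2), of u] that by (simp add: add.commute)
  define W where "W a u = (if a then x u else if u < c - b then x (b + u) else x (u - (c - b)))" for a u
  have "W True i0 \<noteq> W False i0" using i0 b(1) c(1) by (simp add: W_def add.commute)
  moreover have "0 \<le> i0" "i0 < c" "c \<ge> 1" using i0 b(1) c(1) by auto
  moreover have "words n {y} = words n X"
    if y: "\<And>i. y i = W (f (i div c)) (i mod c)" and f: "f k" for f y k
  proof
    have at: "y (j * c + u) = W (f j) u" if "0 \<le> u" "u < c" for j u
      using that by (simp add: y)
    have start: "y (j * c + u) = x u" if "0 \<le> u" "u < int n" for j u
      using that at[of u j] xb[of u] b(1) c(1) i0(1) by (simp add: W_def)
    have next_start: "y (j * c + u) = x (u - c)" if "c \<le> u" "u < c + int n" for j u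
      using start[of "u - c" "j + 1"] that by (simp add: algebra_simps)
    have in_words: "window n y i \<in> words n X" if "\<And>u. 0 \<le> u \<Longrightarrow> u < int n \<Longrightarrow> y (i + u) = x (l + u)" for i l
    proof -
      have "window n y i = window n x l" by (rule window_cong) (rule that)
      then show ?thesis using x by (auto simp: words_eq_windows)
    qed
    have "window n y i \<in> words n X" for i
    proof -
      define j where "j = i div c"
      define u where "u = i mod c"
      have u: "0 \<le> u" "u < c" using \<open>c \<ge> 1\<close> by (simp_all add: u_def)
      have i: "i = j * c + u" by (simp add: j_def u_def)
      have split: "i + v = j * c + (u + v)" for v by (simp add: i)
      consider "f j" | "\<not> f j" "u < c - b" | "\<not> f j" "u \<ge> c - b" by linarith
      then show ?thesis
      proof cases
        case 1
        show ?thesis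
        proof (rule in_words[of i u])
          fix v assume v: "0 \<le> v" "v < int n"
          show "y (i + v) = x (u + v)"
            using 1 v u at[of "u + v" j] next_start[of "u + v" j] xc[of "u + v - c"]
            unfolding split by (cases "u + v < c") (auto simp: W_def)
        qed
      next
        case 2
        show ?thesis
        proof (rule in_words[of i "b + u"])
          fix v assume v: "0 \<le> v" "v < int n"
          show "y (i + v) = x (b + u + v)"
            using 2 v u at[of "u + v" j] xc[of "u + v - (c - b)"] b(1)
            unfolding split by (cases "u + v < c - b") (auto simp: W_def algebra_simps)
        qed
      next
        case 3
        show ?thesis
        proof (rule in_words[of i "u - (c - b)"])
          fix v assume v: "0 \<le> v" "v < int n"
          show "y (i + v) = x (u - (c - b) + v)"
            using 3 v u at[of "u + v" j] next_start[of "u + v" j] xb[of "u + v - c"]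
            unfolding split by (cases "u + v < c") (auto simp: W_def algebra_simps)
        qed
      qed
    qed
    then show "words n {y} \<subseteq> words n X" by (auto simp: words_eq_windows)
    show "words n X \<subseteq> words n {y}"
    proof
      fix w assume "w \<in> words n X"
      then obtain i where i: "0 \<le> i" "i + int n \<le> b0" "window n x i = w" using b0 by blast
      have "window n y (k * c + i) = window n x i"
      proof (rule window_cong)
        fix j assume "0 \<le> j" "j < int n"
        then show "y (k * c + i + j) = x (i + j)"
          using at[of "i + j" k] f i b(1) c(1) i0(1) by (simp add: W_def add.assoc)
      qed
      then show "w \<in> words n {y}" using i(3) by (auto simp: words_eq_windows)
    qed
  qed
  ultimately show ?thesis by (intro exI[of _ c] exI[of _ W]) blast
qed

section \<open>Genericity\<close>

text \<open>
  The approximating subshift is the orbit closure of the expansion of \<open>rigid_seq\<close> by blocks that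
  reproduce the words of \<open>X\<close>.
\<close>

lemma chiral_toeplitz_dense:
  assumes X: "X \<in> infinite_minimal_subshifts"
  shows "\<exists>Y\<in>infinite_minimal_subshifts. words n X = words n Y \<and>
           (\<forall>m. locally_periodic m Y \<and> reflection_rigid m Y)"
proof -
  obtain h W where h: "h \<ge> 1" and d: "\<exists>d. 0 \<le> d \<and> d < h \<and> W True d \<noteq> W False d"
    and W: "\<And>f y. (\<And>i. y i = W (f (i div h)) (i mod h)) \<Longrightarrow> \<exists>k. f k \<Longrightarrow> words n {y} = words n X"
    using blocks_with_words_of[of X n] X unfolding infinite_minimal_subshifts_def by blast
  define y where "y i = W (rigid_seq (i div h)) (i mod h)" for i
  have exp: "block_expansion h W y" using h d by (simp add: block_expansion_def y_def)
  define A where "A = (\<Union>a. W a ` {0..<h})"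
  have "y i \<in> A" for i
    unfolding A_def y_def using h by (intro UN_I[of "rigid_seq (i div h)"] imageI) simp_all
  then have A: "finite A" "y \<in> full_shift A" by (simp_all add: A_def full_shift_def)
  define Y where "Y = top_of_set (full_shift A) closure_of shift_orbit y"
  note toeplitz = toeplitz_expansion[OF exp]
  note Y = toeplitz_orbit_closure[OF A toeplitz Y_def]
  have "rigid_seq 1" by (simp add: rigid_seq.simps)
  then have "\<exists>k. rigid_seq k" by blast
  then have "words n {y} = words n X" by (intro W[of y rigid_seq]) (simp_all add: y_def)
  then have "words n X = words n Y" using words_orbit_closure[OF Y(3,2)] by simp
  moreover have rigid: "reflection_rigid m Y" for m by (rule block_expansion_rigid[OF Y(3,2) exp])
  moreover have "infinite Y"
    using finite_minimal_conjugate_inverse[OF Y(1)]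
      reflection_rigid_not_conjugate[OF minimal_imp_subshift[OF Y(1)] rigid] by blast
  moreover have "locally_periodic m Y" for m
    by (rule toeplitz_imp_locally_periodic[OF Y(1,2) toeplitz])
  ultimately show ?thesis
    using Y(1) by (intro bexI[of _ Y]) (simp_all add: infinite_minimal_subshifts_def)
qed

theorem corollary6p7:
  shows "generic_in minimal_subshift_topology
           {X. toeplitz_subshift X \<and> \<not> conjugate_systems X shift X (inv shift)}"
proof -
  let ?C = "{X. toeplitz_subshift X \<and> \<not> conjugate_systems X shift X (inv shift)}"
  define U where "U n = {X \<in> infinite_minimal_subshifts. locally_periodic n X \<and> reflection_rigid n X}" for n
  define G where "G = (\<Inter>n. U n)"
  have open_U: "openin minimal_subshift_topology (U n)" for n
  proof (rule openin_minimal_subshift_topologyI)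
    show "U n \<subseteq> infinite_minimal_subshifts" by (auto simp: U_def)
    fix X assume "X \<in> U n"
    then have X: "subshift X" "locally_periodic n X" "reflection_rigid n X"
      by (auto simp: U_def infinite_minimal_subshifts_def minimal_imp_subshift)
    obtain k l where
      k: "\<And>Y. subshift Y \<Longrightarrow> words k X = words k Y \<Longrightarrow> locally_periodic n Y" and
      l: "\<And>Y. subshift Y \<Longrightarrow> words l X = words l Y \<Longrightarrow> reflection_rigid n Y"
      using locally_periodic_open[OF X(1,2)] reflection_rigid_open[OF X(1,3)] by metis
    have "Y \<in> U n" if "Y \<in> infinite_minimal_subshifts" "words (max k l) X = words (max k l) Y" for Y
    proof -
      have "subshift Y" using that(1) by (simp add: infinite_minimal_subshifts_def minimal_imp_subshift)
      moreover have "words k X = words k Y" "words l X = words l Y"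
        using words_eq_antimono[OF that(2)] by simp_all
      ultimately show ?thesis using that(1) k l by (simp add: U_def)
    qed
    then show "\<exists>k. \<forall>Y\<in>infinite_minimal_subshifts. words k X = words k Y \<longrightarrow> Y \<in> U n" by blast
  qed
  have G_eq: "G = {X \<in> infinite_minimal_subshifts. \<forall>n. locally_periodic n X \<and> reflection_rigid n X}"
    by (auto simp: G_def U_def)
  have "gdelta_in minimal_subshift_topology G"
    unfolding G_def by (rule gdelta_in_Inter) (auto intro: open_imp_gdelta_in open_U)
  moreover have "G \<subseteq> ?C"
  proof
    fix X assume "X \<in> G"
    then have X: "minimal_subshift X" "infinite X" "\<And>n. locally_periodic n X" "\<And>n. reflection_rigid n X"
      by (auto simp: G_eq infinite_minimal_subshifts_def)
    have "X \<noteq> {}" using X(2) by auto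
    then have "toeplitz_subshift X"
      using locally_periodic_imp_toeplitz_sequence[OF X(1) _ X(3)] minimal_with_toeplitz_sequence[OF X(1)] by blast
    then show "X \<in> ?C"
      using reflection_rigid_not_conjugate[OF minimal_imp_subshift[OF X(1)] X(4)] by simp
  qed
  moreover have "minimal_subshift_topology closure_of G = topspace minimal_subshift_topology"
  proof (rule dense_in_minimal_subshift_topologyI)
    show "G \<subseteq> infinite_minimal_subshifts" by (auto simp: G_eq)
    show "\<exists>Y\<in>G. words n X = words n Y" if "X \<in> infinite_minimal_subshifts" for X n
      using chiral_toeplitz_dense[OF that, of n] by (auto simp: G_eq)
  qed
  moreover have "?C \<subseteq> topspace minimal_subshift_topology"
    using toeplitz_minimal finite_minimal_conjugate_inverse
    unfolding topspace_minimal_subshift_topology infinite_minimal_subshifts_def by blast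
  ultimately show ?thesis unfolding generic_in_def by blast
qed

end
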